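(* Let $H\ge1$, $m\ge1$ be integers and $\Phi\in\mathbb{R}^{|\mathcal S|\times d}$ a feature matrix. Consider the stochastic iteration with $V_k=\Phi\theta_k$: $$V_{k+1}=(1-\gamma_k)V_k+\gamma_k\,\mathcal M_k\big(T^m_{\mu_{k+1},\nu_{k+1}}T^{H-1}V_k+w_k\big),$$ where $(\mu_{k+1},\nu_{k+1})$ is any pair of stationary randomized policies with $T_{\mu_{k+1},\nu_{k+1}}(T^{H-1}V_k)=T^HV_k$; $\mathcal D_k\subseteq\mathcal S$ is the (random) set of states visited at iteration $k$ by a trajectory under $(\mu_{k+1},\nu_{k+1})$ whose starting state is drawn from a fixed distribution $p$ with $p(s)>0$ for all $s\in\mathcal S$; $\mathcal M_k:=\Phi(\mathcal P_{1,k}\Phi)^+\mathcal P_{2,k}$, where $\mathcal P_{1,k}$, $\mathcal P_{2,k}$ are $0/1$ selection matrices picking the rows/coordinates indexed by $\mathcal D_k$ and $(\cdot)^+$ is the Moore–Penrose pseudoinverse; and $w_k$ is a noise vector that is conditionally unbiased given the past, $E[w_k\mid\mathcal F_k]=0$ (with $\mathcal F_k$ the history up to iteration $k$), with bounded conditional second moments. Define $\delta'_{FV}:=\sup_k\|\mathcal M_k\|_\infty$ and $$\delta'_{app}:=\sup_kE\Big[\big\|\mathcal M_k(J^{\mu_{k+1},\nu_{k+1}}+w_k)-(J^{\mu_{k+1},\nu_{k+1}}+w_k)\big\|_\infty\,\Big|\,\mathcal F_k\Big].$$ Assume $\delta'_{FV}\alpha^{m+H-1}\frac{1+\alpha}{1-\alpha}+\frac{2\alpha^{H-1}}{1-\alpha}<1$,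 and the stepsizes satisfy $\sum_k\gamma_k=\infty$, $\sum_k\gamma_k^2<\infty$. Then almost surely $$\limsup_{k\to\infty}\|V_k-J^*\|_\infty\le\frac{\delta'_{app}}{1-\Big(\alpha^{H-1}+(1+\alpha)\frac{(1+\alpha^m\delta'_{FV})\alpha^{H-1}}{1-\alpha}\Big)}.$$
   Context: A two-player zero-sum discounted Markov game has a finite state space $\mathcal S$, finite action sets $\mathcal U(s)$ (maximizer) and $\mathcal V(s)$ (minimizer) at each state $s$, transition probabilities $P(s'|s,u,v)$, reward $g(s,u,v)\in[0,1]$, and discount factor $\alpha\in(0,1)$. A (stationary randomized) policy pair $(\mu,\nu)$ assigns to each $s$ distributions $\mu(s)\in\Delta(\mathcal U(s))$, $\nu(s)\in\Delta(\mathcal V(s))$. For $V\in\mathbb{R}^{|\mathcal S|}$ and $s\in\mathcal S$ let $A_{V,s}(u,v)=g(s,u,v)+\alpha\sum_{s'}P(s'|s,u,v)V(s')$. Define $T_{\mu,\nu}V(s)=\mu(s)^\top A_{V,s}\nu(s)$ and the Bellman operator $TV(s)=\max_{p\in\Delta(\mathcal U(s))}\min_{q\in\Delta(\mathcal V(s))}p^\top A_{V,s}q$. $J^{\mu,\nu}$ is the unique fixed point of $T_{\mu,\nu}$ and $J^*$ the unique fixed point of $T$ (the Nash equilibrium value). $T^j$, $T^j_{\mu,\nu}$ denote $j$-fold compositions, $T^0$ the identity. Note the assumed inequality on $\delta'_{FV},m,H$ is equivalent to the denominator in the conclusion being positive. *)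

theory Defs
  imports "HOL-Probability.Probability"
begin

text \<open>Action sets: Ua s (maximizer), Wa s (minimizer). Transition kernel P s u v s',
  reward g s u v, discount al.\<close>

definition markov_game ::
  "('s::finite \<Rightarrow> 'u set) \<Rightarrow> ('s \<Rightarrow> 'v set) \<Rightarrow> ('s \<Rightarrow> 'u \<Rightarrow> 'v \<Rightarrow> 's \<Rightarrow> real)
   \<Rightarrow> ('s \<Rightarrow> 'u \<Rightarrow> 'v \<Rightarrow> real) \<Rightarrow> real \<Rightarrow> bool" where
  "markov_game Ua Wa P g al \<longleftrightarrow>
     (\<forall>s. finite (Ua s) \<and> Ua s \<noteq> {} \<and> finite (Wa s) \<and> Wa s \<noteq> {}) \<and>
     (\<forall>s u v s'. P s u v s' \<ge> 0) \<and>
     (\<forall>s. \<forall>u\<in>Ua s. \<forall>v\<in>Wa s. (\<Sum>s'\<in>UNIV. P s u v s') = 1) \<and>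
     (\<forall>s u v. 0 \<le> g s u v \<and> g s u v \<le> 1) \<and>
     0 < al \<and> al < 1"

definition is_distr :: "'a set \<Rightarrow> ('a \<Rightarrow> real) \<Rightarrow> bool" where
  "is_distr A q \<longleftrightarrow> (\<forall>a. 0 \<le> q a) \<and> (\<forall>a. a \<notin> A \<longrightarrow> q a = 0) \<and> (\<Sum>a\<in>A. q a) = 1"

definition is_policy :: "('s \<Rightarrow> 'a set) \<Rightarrow> ('s \<Rightarrow> 'a \<Rightarrow> real) \<Rightarrow> bool" where
  "is_policy A mu \<longleftrightarrow> (\<forall>s. is_distr (A s) (mu s))"

definition Agame ::
  "('s::finite \<Rightarrow> 'u \<Rightarrow> 'v \<Rightarrow> 's \<Rightarrow> real) \<Rightarrow> ('s \<Rightarrow> 'u \<Rightarrow> 'v \<Rightarrow> real) \<Rightarrow> real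
   \<Rightarrow> ('s \<Rightarrow> real) \<Rightarrow> 's \<Rightarrow> 'u \<Rightarrow> 'v \<Rightarrow> real" where
  "Agame P g al V s u v = g s u v + al * (\<Sum>s'\<in>UNIV. P s u v s' * V s')"

definition Tpol ::
  "('s::finite \<Rightarrow> 'u set) \<Rightarrow> ('s \<Rightarrow> 'v set) \<Rightarrow> ('s \<Rightarrow> 'u \<Rightarrow> 'v \<Rightarrow> 's \<Rightarrow> real)
   \<Rightarrow> ('s \<Rightarrow> 'u \<Rightarrow> 'v \<Rightarrow> real) \<Rightarrow> real
   \<Rightarrow> ('s \<Rightarrow> 'u \<Rightarrow> real) \<Rightarrow> ('s \<Rightarrow> 'v \<Rightarrow> real) \<Rightarrow> ('s \<Rightarrow> real) \<Rightarrow> ('s \<Rightarrow> real)" where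
  "Tpol Ua Wa P g al mu nu V s =
     (\<Sum>u\<in>Ua s. \<Sum>v\<in>Wa s. mu s u * Agame P g al V s u v * nu s v)"

definition Tbell ::
  "('s::finite \<Rightarrow> 'u set) \<Rightarrow> ('s \<Rightarrow> 'v set) \<Rightarrow> ('s \<Rightarrow> 'u \<Rightarrow> 'v \<Rightarrow> 's \<Rightarrow> real)
   \<Rightarrow> ('s \<Rightarrow> 'u \<Rightarrow> 'v \<Rightarrow> real) \<Rightarrow> real \<Rightarrow> ('s \<Rightarrow> real) \<Rightarrow> ('s \<Rightarrow> real)" where
  "Tbell Ua Wa P g al V s =
     (SUP p\<in>{p. is_distr (Ua s) p}. INF q\<in>{q. is_distr (Wa s) q}.
        (\<Sum>u\<in>Ua s. \<Sum>v\<in>Wa s. p u * Agame P g al V s u v * q v))"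

definition Jpol where
  "Jpol Ua Wa P g al mu nu = (THE J. Tpol Ua Wa P g al mu nu J = J)"

definition Jstar where
  "Jstar Ua Wa P g al = (THE J. Tbell Ua Wa P g al J = J)"

definition supnorm :: "('s::finite \<Rightarrow> real) \<Rightarrow> real" where
  "supnorm V = (MAX s. \<bar>V s\<bar>)"

text \<open>Moore--Penrose pseudoinverse of a matrix A with rows indexed by the finite set R and
  columns indexed by the finite set C (entries outside R x C are irrelevant); the result has
  rows indexed by C and columns indexed by R and is set to 0 outside C x R.\<close>
definition is_pinv :: "'r set \<Rightarrow> 'c set \<Rightarrow> ('r \<Rightarrow> 'c \<Rightarrow> real) \<Rightarrow> ('c \<Rightarrow> 'r \<Rightarrow> real) \<Rightarrow> bool" where
  "is_pinv R C A B \<longleftrightarrow>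
     (\<forall>i j. i \<notin> C \<or> j \<notin> R \<longrightarrow> B i j = 0) \<and>
     (\<forall>i\<in>R. \<forall>j\<in>C. (\<Sum>k\<in>C. \<Sum>l\<in>R. A i k * B k l * A l j) = A i j) \<and>
     (\<forall>i\<in>C. \<forall>j\<in>R. (\<Sum>k\<in>R. \<Sum>l\<in>C. B i k * A k l * B l j) = B i j) \<and>
     (\<forall>i\<in>R. \<forall>j\<in>R. (\<Sum>k\<in>C. A i k * B k j) = (\<Sum>k\<in>C. A j k * B k i)) \<and>
     (\<forall>i\<in>C. \<forall>j\<in>C. (\<Sum>k\<in>R. B i k * A k j) = (\<Sum>k\<in>R. B j k * A k i))"

definition pinv :: "'r set \<Rightarrow> 'c set \<Rightarrow> ('r \<Rightarrow> 'c \<Rightarrow> real) \<Rightarrow> ('c \<Rightarrow> 'r \<Rightarrow> real)" where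
  "pinv R C A = (THE B. is_pinv R C A B)"

text \<open>The |S| x |S| matrix  M_D = Phi (P_1 Phi)^+ P_2, where P_1, P_2 select the rows/coordinates
  in D: P_1 Phi is Phi restricted to the rows in D, and P_2 x is x restricted to D.\<close>
definition Mmat :: "('s::finite \<Rightarrow> 'd::finite \<Rightarrow> real) \<Rightarrow> 's set \<Rightarrow> 's \<Rightarrow> 's \<Rightarrow> real" where
  "Mmat Phi D s t = (if t \<in> D then (\<Sum>j\<in>UNIV. Phi s j * pinv D UNIV Phi j t) else 0)"

definition Mop :: "('s::finite \<Rightarrow> 'd::finite \<Rightarrow> real) \<Rightarrow> 's set \<Rightarrow> ('s \<Rightarrow> real) \<Rightarrow> ('s \<Rightarrow> real)" where
  "Mop Phi D x s = (\<Sum>t\<in>UNIV. Mmat Phi D s t * x t)"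

definition matnorm_inf :: "('s::finite \<Rightarrow> 's \<Rightarrow> real) \<Rightarrow> real" where
  "matnorm_inf A = (MAX s. \<Sum>t\<in>UNIV. \<bar>A s t\<bar>)"

definition Ppol ::
  "('s \<Rightarrow> 'u set) \<Rightarrow> ('s \<Rightarrow> 'v set) \<Rightarrow> ('s \<Rightarrow> 'u \<Rightarrow> 'v \<Rightarrow> 's \<Rightarrow> real)
   \<Rightarrow> ('s \<Rightarrow> 'u \<Rightarrow> real) \<Rightarrow> ('s \<Rightarrow> 'v \<Rightarrow> real) \<Rightarrow> 's \<Rightarrow> 's \<Rightarrow> real" where
  "Ppol Ua Wa P mu nu s s' = (\<Sum>u\<in>Ua s. \<Sum>v\<in>Wa s. mu s u * nu s v * P s u v s')"

definition traj_visit_prob ::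
  "('s::finite \<Rightarrow> 'u set) \<Rightarrow> ('s \<Rightarrow> 'v set) \<Rightarrow> ('s \<Rightarrow> 'u \<Rightarrow> 'v \<Rightarrow> 's \<Rightarrow> real)
   \<Rightarrow> ('s \<Rightarrow> real) \<Rightarrow> nat \<Rightarrow> ('s \<Rightarrow> 'u \<Rightarrow> real) \<Rightarrow> ('s \<Rightarrow> 'v \<Rightarrow> real) \<Rightarrow> 's set \<Rightarrow> real" where
  "traj_visit_prob Ua Wa P p L mu nu S =
     (\<Sum>xs\<in>{xs. length xs = Suc L \<and> set xs = S}.
        p (hd xs) * (\<Prod>i<L. Ppol Ua Wa P mu nu (xs ! i) (xs ! Suc i)))"

end

theory Submission
  imports Defs
begin

text \<open>
  Write \<open>J\<^sub>k\<close> for the value of the policy pair used at iteration \<open>k\<close>. The error \<open>x\<^sub>k = V\<^sub>k - J*\<close>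
  satisfies \<open>x\<^sub>k\<^sub>+\<^sub>1 = (1 - \<gamma>\<^sub>k) x\<^sub>k + \<gamma>\<^sub>k (a\<^sub>k + Z\<^sub>k)\<close>, where \<open>Z\<^sub>k = M\<^sub>k (J\<^sub>k + w\<^sub>k) - J\<^sub>k\<close> and
  \<open>a\<^sub>k = M\<^sub>k (T\<^sub>\<mu>\<^sub>,\<^sub>\<nu>^m T^(H-1) V\<^sub>k - J\<^sub>k) + (J\<^sub>k - J*)\<close>. Contraction of the Bellman operators and greediness
  bound \<open>a\<^sub>k\<close> on every path by \<open>\<beta>\<close> times the norm of \<open>x\<^sub>k\<close>, where \<open>1 - \<beta>\<close> is the denominator of the
  claimed bound. Since \<open>w\<^sub>k\<close> is conditionally unbiased, the conditional mean of each coordinate of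
  \<open>Z\<^sub>k\<close> is at most \<open>\<delta>'\<^sub>a\<^sub>p\<^sub>p\<close> in absolute value. The centred noise has bounded variance, so the martingale
  with increments \<open>\<gamma>\<^sub>k (Z\<^sub>k - E[Z\<^sub>k | F\<^sub>k])\<close> converges almost surely. Subtracting its tail \<open>R\<^sub>k \<rightarrow> 0\<close> from
  \<open>x\<^sub>k\<close> gives a noise-free recursion whose norm \<open>u\<^sub>k\<close> obeys
  \<open>u\<^sub>k\<^sub>+\<^sub>1 \<le> (1 - (1 - \<beta>) \<gamma>\<^sub>k) u\<^sub>k + \<gamma>\<^sub>k (\<delta>'\<^sub>a\<^sub>p\<^sub>p + o(1))\<close>, hence the bound.
\<close>

section \<open>Contractions in the supremum norm\<close>

lemma abs_le_supnorm: "\<bar>X s\<bar> \<le> supnorm X"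
  unfolding supnorm_def by (rule Max_ge) auto

lemma supnorm_le: "(\<And>s. \<bar>X s\<bar> \<le> c) \<Longrightarrow> supnorm X \<le> c"
  unfolding supnorm_def by (subst Max_le_iff) auto

lemma supnorm_nonneg: "0 \<le> supnorm X"
  using abs_le_supnorm[of X undefined] abs_ge_zero[of "X undefined"] by linarith

lemma supnorm_minus_commute: "supnorm (\<lambda>s. X s - Y s) = supnorm (\<lambda>s. Y s - X s)"
  unfolding supnorm_def by (subst abs_minus_commute) (rule refl)

lemma supnorm_triangle:
  "supnorm (\<lambda>s. X s - Z s) \<le> supnorm (\<lambda>s. X s - Y s) + supnorm (\<lambda>s. Y s - Z s)"
proof (rule supnorm_le)
  fix s
  show "\<bar>X s - Z s\<bar> \<le> supnorm (\<lambda>s. X s - Y s) + supnorm (\<lambda>s. Y s - Z s)"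
    using abs_le_supnorm[of "\<lambda>s. X s - Y s" s] abs_le_supnorm[of "\<lambda>s. Y s - Z s" s] by linarith
qed

lemma supnorm_eq_0D:
  assumes "supnorm (\<lambda>s. X s - Y s) \<le> 0"
  shows "X = Y"
proof
  fix s show "X s = Y s"
    using abs_le_supnorm[of "\<lambda>s. X s - Y s" s] assms by linarith
qed

text \<open>Finiteness of the index set makes pointwise convergence uniform: the norm is dominated
  by the sum of the absolute coordinates.\<close>

lemma supnorm_tendsto_0:
  assumes "\<And>s. (\<lambda>n. X n s) \<longlonglongrightarrow> 0"
  shows "(\<lambda>n. supnorm (X n)) \<longlonglongrightarrow> 0"
proof (rule tendsto_sandwich[OF _ _ tendsto_const])
  show "\<forall>\<^sub>F n in sequentially. 0 \<le> supnorm (X n)" by (simp add: supnorm_nonneg)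
  show "\<forall>\<^sub>F n in sequentially. supnorm (X n) \<le> (\<Sum>s\<in>UNIV. \<bar>X n s\<bar>)"
    by (intro always_eventually allI supnorm_le member_le_sum) auto
  show "(\<lambda>n. \<Sum>s\<in>UNIV. \<bar>X n s\<bar>) \<longlonglongrightarrow> 0"
    using assms by (intro tendsto_null_sum) (auto intro: tendsto_rabs_zero)
qed

definition sup_contraction :: "real \<Rightarrow> (('s::finite \<Rightarrow> real) \<Rightarrow> 's \<Rightarrow> real) \<Rightarrow> bool" where
  "sup_contraction c T \<longleftrightarrow> 0 \<le> c \<and> c < 1 \<and>
     (\<forall>X Y. supnorm (\<lambda>s. T X s - T Y s) \<le> c * supnorm (\<lambda>s. X s - Y s))"

lemma sup_contraction_funpow:
  assumes "sup_contraction c T"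
  shows "supnorm (\<lambda>s. (T ^^ n) X s - (T ^^ n) Y s) \<le> c ^ n * supnorm (\<lambda>s. X s - Y s)"
proof (induction n)
  case (Suc n)
  have "supnorm (\<lambda>s. (T ^^ Suc n) X s - (T ^^ Suc n) Y s)
      \<le> c * supnorm (\<lambda>s. (T ^^ n) X s - (T ^^ n) Y s)"
    using assms by (auto simp: sup_contraction_def)
  also have "\<dots> \<le> c * (c ^ n * supnorm (\<lambda>s. X s - Y s))"
    using assms Suc by (intro mult_left_mono) (auto simp: sup_contraction_def)
  finally show ?case by (simp add: mult.assoc)
qed simp

lemma sup_contraction_funpow_fixed:
  assumes "sup_contraction c T" and "T J = J"
  shows "supnorm (\<lambda>s. (T ^^ n) X s - J s) \<le> c ^ n * supnorm (\<lambda>s. X s - J s)"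
proof -
  have "(T ^^ n) J = J" by (induction n) (use assms in auto)
  then show ?thesis using sup_contraction_funpow[OF assms(1), of n X J] by simp
qed

text \<open>The distance \<open>e\<close> from \<open>X\<close> to the fixed point is at most the
  residual plus \<open>c * e\<close>; solving for \<open>e\<close> gives the bound. It turns a small
  residual of a greedy policy into closeness to the value of that policy.\<close>

lemma sup_contraction_dist_fixed:
  assumes "sup_contraction c T" and "T J = J"
  shows "supnorm (\<lambda>s. X s - J s) \<le> supnorm (\<lambda>s. T X s - X s) / (1 - c)"
proof -
  have "supnorm (\<lambda>s. X s - J s) \<le> supnorm (\<lambda>s. X s - T X s) + supnorm (\<lambda>s. T X s - J s)"
    by (rule supnorm_triangle)
  also have "supnorm (\<lambda>s. T X s - J s) \<le> c * supnorm (\<lambda>s. X s - J s)"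
    using sup_contraction_funpow_fixed[OF assms, of 1 X] by simp
  finally show ?thesis
    using assms(1) by (simp add: sup_contraction_def field_simps supnorm_minus_commute[of X])
qed

lemma sup_contraction_unique:
  assumes "sup_contraction c T" and "T J = J" and "T J' = J'"
  shows "J = J'"
proof -
  have "supnorm (\<lambda>s. J s - J' s) \<le> supnorm (\<lambda>s. T J s - J s) / (1 - c)"
    by (rule sup_contraction_dist_fixed) (use assms in auto)
  also have "\<dots> = 0" using assms by (simp add: supnorm_def)
  finally show ?thesis by (rule supnorm_eq_0D)
qed

text \<open>Picard iteration from zero: successive differences decay geometrically, so every
  coordinate converges, and the limit is fixed because the residual at the limit is bounded by
  quantities that vanish along the iterates.\<close>

lemma sup_contraction_fixed_exists:
  assumes "sup_contraction c T"
  shows "\<exists>J. T J = J"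
proof -
  define X where "X n = (T ^^ n) (\<lambda>_. 0)" for n
  have c: "0 \<le> c" "c < 1" using assms by (auto simp: sup_contraction_def)
  have X_Suc: "X (Suc n) = T (X n)" for n by (simp add: X_def)
  have step: "supnorm (\<lambda>s. X (Suc n) s - X n s) \<le> c ^ n * supnorm (\<lambda>s. T (\<lambda>_. 0) s - 0)" for n
    using sup_contraction_funpow[OF assms, of n "T (\<lambda>_. 0)" "\<lambda>_. 0"]
    by (simp add: X_def funpow_swap1)
  have "convergent (\<lambda>n. X n s)" for s
  proof -
    have "summable (\<lambda>n. X (Suc n) s - X n s)"
    proof (rule summable_comparison_test')
      show "summable (\<lambda>n. c ^ n * supnorm (\<lambda>s. T (\<lambda>_. 0) s - 0))"
        using c by (intro summable_mult2 summable_geometric) auto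
      show "norm (X (Suc n) s - X n s) \<le> c ^ n * supnorm (\<lambda>s. T (\<lambda>_. 0) s - 0)" if "n \<ge> 0" for n
        using abs_le_supnorm[of "\<lambda>s. X (Suc n) s - X n s" s] step[of n] by simp
    qed
    then have "convergent (\<lambda>n. \<Sum>i<n. X (Suc i) s - X i s)"
      by (simp add: summable_iff_convergent)
    then show ?thesis
      by (simp only: sum_lessThan_telescope[of "\<lambda>n. X n s"] convergent_diff_const_right_iff)
  qed
  then obtain J where J: "\<And>s. (\<lambda>n. X n s) \<longlonglongrightarrow> J s"
    unfolding convergent_def by metis
  have lim: "(\<lambda>n. supnorm (\<lambda>s. X n s - J s)) \<longlonglongrightarrow> 0"
    using J by (intro supnorm_tendsto_0) (simp add: LIM_zero)
  have "supnorm (\<lambda>s. T J s - J s) \<le> c * supnorm (\<lambda>s. X n s - J s) + supnorm (\<lambda>s. X (Suc n) s - J s)" for n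
  proof -
    have "supnorm (\<lambda>s. T J s - J s)
        \<le> supnorm (\<lambda>s. T J s - X (Suc n) s) + supnorm (\<lambda>s. X (Suc n) s - J s)"
      by (rule supnorm_triangle)
    also have "supnorm (\<lambda>s. T J s - X (Suc n) s) \<le> c * supnorm (\<lambda>s. J s - X n s)"
      using assms by (auto simp: sup_contraction_def X_Suc)
    finally show ?thesis by (simp add: supnorm_minus_commute[of J])
  qed
  moreover have "(\<lambda>n. c * supnorm (\<lambda>s. X n s - J s) + supnorm (\<lambda>s. X (Suc n) s - J s)) \<longlonglongrightarrow> c * 0 + 0"
    by (intro tendsto_add tendsto_mult tendsto_const lim filterlim_compose[OF lim filterlim_Suc])
  ultimately have "supnorm (\<lambda>s. T J s - J s) \<le> 0"
    by (metis (no_types, lifting) LIMSEQ_le_const add_0_right mult_zero_right)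
  then show ?thesis by (metis supnorm_eq_0D)
qed

text \<open>Serves to exhibit the value of a random policy pair as a pointwise limit of measurable
  iterates.\<close>

lemma sup_contraction_funpow_tendsto:
  assumes "sup_contraction c T" and "T J = J"
  shows "(\<lambda>n. (T ^^ n) X s) \<longlonglongrightarrow> J s"
proof -
  have "(\<lambda>n. c ^ n * supnorm (\<lambda>s. X s - J s)) \<longlonglongrightarrow> 0"
    using assms(1) by (intro tendsto_mult_left_zero LIMSEQ_power_zero) (auto simp: sup_contraction_def)
  moreover have "\<bar>(T ^^ n) X s - J s\<bar> \<le> c ^ n * supnorm (\<lambda>s. X s - J s)" for n
    using abs_le_supnorm[of "\<lambda>s. (T ^^ n) X s - J s" s]
      sup_contraction_funpow_fixed[OF assms, of n X] by linarith
  ultimately have "(\<lambda>n. (T ^^ n) X s - J s) \<longlonglongrightarrow> 0"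
    by - (rule Lim_null_comparison[OF always_eventually], auto)
  then show ?thesis by (simp add: LIM_zero_iff)
qed

text \<open>Existence and uniqueness together ensure that the definite descriptions behind
  \<open>Jpol\<close> and \<open>Jstar\<close> denote fixed points.\<close>

lemma the_fixed_point:
  assumes "sup_contraction c T"
  shows "T (THE J. T J = J) = (THE J. T J = J)"
proof (rule theI'[of "\<lambda>J. T J = J"], rule ex_ex1I)
  show "\<exists>J. T J = J" by (rule sup_contraction_fixed_exists[OF assms])
  show "J = J'" if "T J = J" "T J' = J'" for J J' by (rule sup_contraction_unique[OF assms that])
qed

section \<open>The Bellman operators and their contraction properties\<close>

definition bilin :: "'u set \<Rightarrow> 'v set \<Rightarrow> ('u \<Rightarrow> 'v \<Rightarrow> real) \<Rightarrow> ('u \<Rightarrow> real) \<Rightarrow> ('v \<Rightarrow> real) \<Rightarrow> real" where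
  "bilin U W A p q = (\<Sum>u\<in>U. \<Sum>v\<in>W. p u * A u v * q v)"

text \<open>The weights \<open>p u * q v\<close> are nonnegative and sum to one, so averaging is
  monotone and passes a constant shift through unchanged.\<close>

lemma bilin_le:
  assumes "is_distr U p" "is_distr W q"
    and AB: "\<And>u v. u \<in> U \<Longrightarrow> v \<in> W \<Longrightarrow> A u v \<le> B u v + c"
  shows "bilin U W A p q \<le> bilin U W B p q + c"
proof -
  have "bilin U W A p q \<le> (\<Sum>u\<in>U. \<Sum>v\<in>W. p u * (B u v + c) * q v)"
    unfolding bilin_def using assms
    by (intro sum_mono mult_right_mono mult_left_mono) (auto simp: is_distr_def)
  also have "\<dots> = bilin U W B p q + c * (\<Sum>u\<in>U. p u) * (\<Sum>v\<in>W. q v)"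
    unfolding bilin_def
    by (simp add: algebra_simps sum.distrib sum_distrib_left sum_distrib_right sum_product)
  finally show ?thesis using assms by (simp add: is_distr_def)
qed

lemma bilin_bounds:
  assumes "is_distr U p" "is_distr W q"
    and A: "\<And>u v. u \<in> U \<Longrightarrow> v \<in> W \<Longrightarrow> \<bar>A u v\<bar> \<le> c"
  shows "bilin U W A p q \<le> c" "- c \<le> bilin U W A p q"
proof -
  have "bilin U W A p q \<le> bilin U W (\<lambda>_ _. 0) p q + c"
    by (rule bilin_le[OF assms(1,2)]) (use A abs_le_D1 in auto)
  moreover have "bilin U W (\<lambda>_ _. 0) p q \<le> bilin U W A p q + c"
    by (rule bilin_le[OF assms(1,2)]) (use A in \<open>fastforce dest: abs_le_D2\<close>)
  ultimately show "bilin U W A p q \<le> c" "- c \<le> bilin U W A p q" by (auto simp: bilin_def)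
qed

lemma is_distr_exists:
  assumes "finite A" "A \<noteq> {}"
  shows "\<exists>q. is_distr A q"
proof -
  obtain a where "a \<in> A" using assms by blast
  then have "is_distr A (\<lambda>x. if x = a then 1 else 0)"
    using assms by (auto simp: is_distr_def)
  then show ?thesis by blast
qed

text \<open>The pointwise inequality survives first the infimum over \<open>q\<close> and then the
  supremum over \<open>p\<close>. Both are taken in the reals, so they need bounded nonempty
  families: a matrix with finitely many entries has uniformly bounded payoffs.\<close>

lemma maxmin_bilin_le:
  assumes fin: "finite U" "U \<noteq> {}" "finite W" "W \<noteq> {}"
    and AB: "\<And>u v. u \<in> U \<Longrightarrow> v \<in> W \<Longrightarrow> A u v \<le> B u v + c"
  shows "(SUP p\<in>Collect (is_distr U). INF q\<in>Collect (is_distr W). bilin U W A p q)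
       \<le> (SUP p\<in>Collect (is_distr U). INF q\<in>Collect (is_distr W). bilin U W B p q) + c"
proof -
  have ne: "Collect (is_distr U) \<noteq> {}" "Collect (is_distr W) \<noteq> {}"
    using is_distr_exists fin by fastforce+
  have bnd: "\<exists>K. \<forall>u\<in>U. \<forall>v\<in>W. \<bar>C u v\<bar> \<le> K" for C :: "'a \<Rightarrow> 'b \<Rightarrow> real"
  proof (intro exI ballI)
    fix u v assume "u \<in> U" "v \<in> W"
    then have "\<bar>C u v\<bar> \<le> (\<Sum>v\<in>W. \<bar>C u v\<bar>)"
      using fin by (intro member_le_sum) auto
    also have "\<dots> \<le> (\<Sum>u\<in>U. \<Sum>v\<in>W. \<bar>C u v\<bar>)"
      using fin \<open>u \<in> U\<close> by (intro member_le_sum[of u U "\<lambda>u. \<Sum>v\<in>W. \<bar>C u v\<bar>"] sum_nonneg) auto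
    finally show "\<bar>C u v\<bar> \<le> (\<Sum>u\<in>U. \<Sum>v\<in>W. \<bar>C u v\<bar>)" .
  qed
  have below: "bdd_below ((\<lambda>q. bilin U W C p q) ` Collect (is_distr W))" if "is_distr U p" for C p
  proof -
    obtain K where K: "\<And>u v. u \<in> U \<Longrightarrow> v \<in> W \<Longrightarrow> \<bar>C u v\<bar> \<le> K" using bnd[of C] by blast
    show ?thesis
      using that K by (intro bdd_belowI2[of _ "- K"] bilin_bounds(2)) auto
  qed
  have above: "bdd_above ((\<lambda>p. INF q\<in>Collect (is_distr W). bilin U W C p q) ` Collect (is_distr U))" for C
  proof -
    obtain K where K: "\<And>u v. u \<in> U \<Longrightarrow> v \<in> W \<Longrightarrow> \<bar>C u v\<bar> \<le> K" using bnd[of C] by blast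
    obtain q where q: "is_distr W q" using ne by blast
    show ?thesis
    proof (rule bdd_aboveI2[of _ _ K])
      fix p assume "p \<in> Collect (is_distr U)"
      then show "(INF q\<in>Collect (is_distr W). bilin U W C p q) \<le> K"
        using q K by (intro cINF_lower2[OF below, of _ q] bilin_bounds(1)) auto
    qed
  qed
  show ?thesis
  proof (rule cSUP_least[OF ne(1)])
    fix p assume p: "p \<in> Collect (is_distr U)"
    have "(INF q\<in>Collect (is_distr W). bilin U W A p q) - c
        \<le> (INF q\<in>Collect (is_distr W). bilin U W B p q)"
    proof (rule cINF_greatest[OF ne(2)])
      fix q assume q: "q \<in> Collect (is_distr W)"
      have "(INF q\<in>Collect (is_distr W). bilin U W A p q) \<le> bilin U W A p q"
        using p q below by (intro cINF_lower) auto
      also have "\<dots> \<le> bilin U W B p q + c"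
        using p q AB by (intro bilin_le) auto
      finally show "(INF q\<in>Collect (is_distr W). bilin U W A p q) - c \<le> bilin U W B p q" by simp
    qed
    also have "\<dots> \<le> (SUP p\<in>Collect (is_distr U). INF q\<in>Collect (is_distr W). bilin U W B p q)"
      using p above by (intro cSUP_upper) auto
    finally show "(INF q\<in>Collect (is_distr W). bilin U W A p q)
       \<le> (SUP p\<in>Collect (is_distr U). INF q\<in>Collect (is_distr W). bilin U W B p q) + c" by simp
  qed
qed

lemma Agame_le:
  assumes "markov_game Ua Wa P g al" and "u \<in> Ua s" and "v \<in> Wa s"
  shows "Agame P g al X s u v \<le> Agame P g al Y s u v + al * supnorm (\<lambda>s. X s - Y s)"
proof -
  have "(\<Sum>s'\<in>UNIV. P s u v s' * X s') \<le> (\<Sum>s'\<in>UNIV. P s u v s' * (Y s' + supnorm (\<lambda>s. X s - Y s)))"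
  proof (intro sum_mono mult_left_mono)
    fix s' show "X s' \<le> Y s' + supnorm (\<lambda>s. X s - Y s)"
      using abs_le_supnorm[of "\<lambda>s. X s - Y s" s'] by linarith
  qed (use assms in \<open>auto simp: markov_game_def\<close>)
  also have "\<dots> = (\<Sum>s'\<in>UNIV. P s u v s' * Y s') + (\<Sum>s'\<in>UNIV. P s u v s') * supnorm (\<lambda>s. X s - Y s)"
    by (simp add: distrib_left sum.distrib sum_distrib_right)
  also have "(\<Sum>s'\<in>UNIV. P s u v s') = 1"
    using assms by (auto simp: markov_game_def)
  finally have "al * (\<Sum>s'\<in>UNIV. P s u v s' * X s')
      \<le> al * ((\<Sum>s'\<in>UNIV. P s u v s' * Y s') + 1 * supnorm (\<lambda>s. X s - Y s))"
    using assms by (intro mult_left_mono) (auto simp: markov_game_def)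
  then show ?thesis by (simp add: Agame_def distrib_left)
qed

text \<open>A one-sided estimate suffices, since exchanging \<open>X\<close> and \<open>Y\<close>
  gives the other side with the same norm.\<close>

lemma sup_contractionI:
  assumes "0 \<le> c" "c < 1" and "\<And>X Y s. T X s \<le> T Y s + c * supnorm (\<lambda>s. X s - Y s)"
  shows "sup_contraction c T"
  unfolding sup_contraction_def
proof (intro conjI allI supnorm_le assms(1,2))
  fix X Y s
  show "\<bar>T X s - T Y s\<bar> \<le> c * supnorm (\<lambda>s. X s - Y s)"
    using assms(3)[of X s Y] assms(3)[of Y s X]
    unfolding supnorm_minus_commute[of Y X] by linarith
qed

lemma Tpol_contraction:
  assumes "markov_game Ua Wa P g al" and "is_policy Ua mu" and "is_policy Wa nu"
  shows "sup_contraction al (Tpol Ua Wa P g al mu nu)"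
proof (rule sup_contractionI)
  fix X Y s
  show "Tpol Ua Wa P g al mu nu X s \<le> Tpol Ua Wa P g al mu nu Y s + al * supnorm (\<lambda>s. X s - Y s)"
    unfolding Tpol_def bilin_def[symmetric]
    by (rule bilin_le) (use assms in \<open>auto simp: is_policy_def intro: Agame_le\<close>)
qed (use assms in \<open>auto simp: markov_game_def\<close>)

lemma Tbell_contraction:
  assumes "markov_game Ua Wa P g al"
  shows "sup_contraction al (Tbell Ua Wa P g al)"
proof (rule sup_contractionI)
  fix X Y s
  show "Tbell Ua Wa P g al X s \<le> Tbell Ua Wa P g al Y s + al * supnorm (\<lambda>s. X s - Y s)"
    unfolding Tbell_def bilin_def[symmetric]
    by (rule maxmin_bilin_le) (use assms in \<open>auto simp: markov_game_def intro: Agame_le[OF assms]\<close>)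
qed (use assms in \<open>auto simp: markov_game_def\<close>)

section \<open>Values of policies and the effect of greediness\<close>

lemma Tpol_Jpol:
  assumes "markov_game Ua Wa P g al" and "is_policy Ua mu" and "is_policy Wa nu"
  shows "Tpol Ua Wa P g al mu nu (Jpol Ua Wa P g al mu nu) = Jpol Ua Wa P g al mu nu"
  unfolding Jpol_def by (rule the_fixed_point[OF Tpol_contraction[OF assms]])

lemma Tbell_Jstar:
  assumes "markov_game Ua Wa P g al"
  shows "Tbell Ua Wa P g al (Jstar Ua Wa P g al) = Jstar Ua Wa P g al"
  unfolding Jstar_def by (rule the_fixed_point[OF Tbell_contraction[OF assms]])

text \<open>The residual at the zero function is the expected one-step reward, which lies in the
  unit interval. The bound is the same for all policies, which is what a uniform variance bound for
  the noise requires.\<close>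

lemma supnorm_Jpol_le:
  assumes "markov_game Ua Wa P g al" and "is_policy Ua mu" and "is_policy Wa nu"
  shows "supnorm (Jpol Ua Wa P g al mu nu) \<le> 1 / (1 - al)"
proof -
  have al: "al < 1" using assms by (simp add: markov_game_def)
  let ?T = "Tpol Ua Wa P g al mu nu" and ?J = "Jpol Ua Wa P g al mu nu"
  have "supnorm (\<lambda>s. 0 - ?J s) \<le> supnorm (\<lambda>s. ?T (\<lambda>_. 0) s - 0) / (1 - al)"
    using sup_contraction_dist_fixed[OF Tpol_contraction[OF assms] Tpol_Jpol[OF assms], of "\<lambda>_. 0"]
    by simp
  also have "\<dots> \<le> 1 / (1 - al)"
  proof (intro divide_right_mono supnorm_le)
    fix s
    have "\<bar>Agame P g al (\<lambda>_. 0) s u v\<bar> \<le> 1" for u v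
      using assms(1) by (simp add: Agame_def markov_game_def)
    then show "\<bar>?T (\<lambda>_. 0) s - 0\<bar> \<le> 1"
      using assms(2,3) bilin_bounds[of "Ua s" "mu s" "Wa s" "nu s" "Agame P g al (\<lambda>_. 0) s" 1]
      by (simp add: Tpol_def bilin_def is_policy_def abs_le_iff)
  qed (use al in simp)
  finally show ?thesis by (simp add: supnorm_def)
qed

text \<open>Put \<open>Y = T^(H-1) X\<close>. Greediness makes the policy residual at
  \<open>Y\<close> equal to \<open>T^(H-1) (T X) - T^(H-1) X\<close>, which is at most
  \<open>al^(H-1) * (1 + al) * e\<close>. The residual bound then places \<open>Y\<close> near the
  policy value, and the triangle inequality through \<open>Y\<close> gives the second
  estimate.\<close>

lemma dist_Jpol_le:
  assumes game: "markov_game Ua Wa P g al" and pol: "is_policy Ua mu" "is_policy Wa nu"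
    and H: "H \<ge> 1"
    and greedy: "Tpol Ua Wa P g al mu nu ((Tbell Ua Wa P g al ^^ (H - 1)) X)
                 = (Tbell Ua Wa P g al ^^ H) X"
  defines "e \<equiv> supnorm (\<lambda>s. X s - Jstar Ua Wa P g al s)"
  shows "supnorm (\<lambda>s. (Tbell Ua Wa P g al ^^ (H - 1)) X s - Jpol Ua Wa P g al mu nu s)
           \<le> (1 + al) * al ^ (H - 1) / (1 - al) * e"
    and "supnorm (\<lambda>s. Jpol Ua Wa P g al mu nu s - Jstar Ua Wa P g al s)
           \<le> (al ^ (H - 1) + (1 + al) * al ^ (H - 1) / (1 - al)) * e"
proof -
  let ?T = "Tbell Ua Wa P g al" and ?J = "Jpol Ua Wa P g al mu nu" and ?Js = "Jstar Ua Wa P g al"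
  have al: "0 < al" "al < 1" using game by (auto simp: markov_game_def)
  note T = Tbell_contraction[OF game]
  \<comment> \<open>The subtraction \<open>H - 1\<close> is truncated; \<open>H \<ge> 1\<close>
    guarantees that exactly one application of \<open>T\<close> is split off.\<close>
  have pow: "(?T ^^ H) X = (?T ^^ (H - 1)) (?T X)"
    using H by (cases H) (auto simp: funpow_swap1)
  have "supnorm (\<lambda>s. ?T X s - X s) \<le> supnorm (\<lambda>s. ?T X s - ?Js s) + supnorm (\<lambda>s. ?Js s - X s)"
    by (rule supnorm_triangle)
  also have "\<dots> \<le> al * e + e"
    using sup_contraction_funpow_fixed[OF T Tbell_Jstar[OF game], of 1 X]
    by (simp add: e_def supnorm_minus_commute[of X])
  finally have TX: "supnorm (\<lambda>s. ?T X s - X s) \<le> (1 + al) * e" by (simp add: algebra_simps)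
  have "supnorm (\<lambda>s. (?T ^^ (H - 1)) X s - ?J s)
      \<le> supnorm (\<lambda>s. (?T ^^ (H - 1)) (?T X) s - (?T ^^ (H - 1)) X s) / (1 - al)"
    using sup_contraction_dist_fixed[OF Tpol_contraction[OF game pol] Tpol_Jpol[OF game pol]]
      greedy pow by metis
  also have "\<dots> \<le> al ^ (H - 1) * ((1 + al) * e) / (1 - al)"
  proof (rule divide_right_mono)
    have "supnorm (\<lambda>s. (?T ^^ (H - 1)) (?T X) s - (?T ^^ (H - 1)) X s)
        \<le> al ^ (H - 1) * supnorm (\<lambda>s. ?T X s - X s)"
      by (rule sup_contraction_funpow[OF T])
    also have "\<dots> \<le> al ^ (H - 1) * ((1 + al) * e)"
      using al TX by (intro mult_left_mono) auto
    finally show "supnorm (\<lambda>s. (?T ^^ (H - 1)) (?T X) s - (?T ^^ (H - 1)) X s)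
        \<le> al ^ (H - 1) * ((1 + al) * e)" .
  qed (use al in simp)
  finally show 1: "supnorm (\<lambda>s. (?T ^^ (H - 1)) X s - ?J s) \<le> (1 + al) * al ^ (H - 1) / (1 - al) * e"
    by (simp add: mult_ac)
  have "supnorm (\<lambda>s. ?J s - ?Js s)
      \<le> supnorm (\<lambda>s. ?J s - (?T ^^ (H - 1)) X s) + supnorm (\<lambda>s. (?T ^^ (H - 1)) X s - ?Js s)"
    by (rule supnorm_triangle)
  also have "\<dots> \<le> (1 + al) * al ^ (H - 1) / (1 - al) * e + al ^ (H - 1) * e"
    using 1 sup_contraction_funpow_fixed[OF T Tbell_Jstar[OF game], of "H - 1" X]
    by (intro add_mono) (simp_all add: e_def supnorm_minus_commute[of ?J])
  finally show "supnorm (\<lambda>s. ?J s - ?Js s) \<le> (al ^ (H - 1) + (1 + al) * al ^ (H - 1) / (1 - al)) * e"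
    by (simp add: algebra_simps)
qed

section \<open>The feature operators and the pathwise drift bound\<close>

lemma Mop_diff: "Mop Phi S X s - Mop Phi S Y s = Mop Phi S (\<lambda>t. X t - Y t) s"
  by (simp add: Mop_def sum_subtractf right_diff_distrib)

lemma abs_Mop_le: "\<bar>Mop Phi S X s\<bar> \<le> matnorm_inf (Mmat Phi S) * supnorm X"
proof -
  have "\<bar>Mop Phi S X s\<bar> \<le> (\<Sum>t\<in>UNIV. \<bar>Mmat Phi S s t\<bar> * \<bar>X t\<bar>)"
    unfolding Mop_def abs_mult[symmetric] by (rule sum_abs)
  also have "\<dots> \<le> (\<Sum>t\<in>UNIV. \<bar>Mmat Phi S s t\<bar> * supnorm X)"
    by (intro sum_mono mult_left_mono abs_le_supnorm) auto
  also have "\<dots> \<le> matnorm_inf (Mmat Phi S) * supnorm X"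
    unfolding sum_distrib_right[symmetric] matnorm_inf_def
    by (intro mult_right_mono supnorm_nonneg Max_ge) auto
  finally show ?thesis .
qed

lemma matnorm_inf_nonneg: "0 \<le> matnorm_inf A"
proof -
  have "0 \<le> (\<Sum>t\<in>UNIV. \<bar>A undefined t\<bar>)" by (simp add: sum_nonneg)
  also have "\<dots> \<le> matnorm_inf A" unfolding matnorm_inf_def by (rule Max_ge) auto
  finally show ?thesis .
qed

text \<open>Two errors add up. The \<open>m\<close> policy steps shrink the distance from
  \<open>T^(H-1) X\<close> to the policy value by \<open>al^m\<close>, after which the operator
  expands it by at most \<open>dFV\<close>; the policy value itself differs from
  \<open>Jstar\<close> as bounded before. The estimate holds for each fixed set \<open>S\<close>,
  hence on every path.\<close>

lemma drift_le:
  assumes game: "markov_game Ua Wa P g al" and pol: "is_policy Ua mu" "is_policy Wa nu"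
    and H: "H \<ge> 1"
    and greedy: "Tpol Ua Wa P g al mu nu ((Tbell Ua Wa P g al ^^ (H - 1)) X)
                 = (Tbell Ua Wa P g al ^^ H) X"
    and dFV: "matnorm_inf (Mmat Phi S) \<le> dFV"
  defines "J \<equiv> Jpol Ua Wa P g al mu nu"
  shows "\<bar>Mop Phi S (\<lambda>t. (Tpol Ua Wa P g al mu nu ^^ m) ((Tbell Ua Wa P g al ^^ (H - 1)) X) t - J t) s
           + (J s - Jstar Ua Wa P g al s)\<bar>
         \<le> (al ^ (H - 1) + (1 + al) * ((1 + al ^ m * dFV) * al ^ (H - 1)) / (1 - al))
             * supnorm (\<lambda>s. X s - Jstar Ua Wa P g al s)"
proof -
  let ?T = "Tbell Ua Wa P g al" and ?Tp = "Tpol Ua Wa P g al mu nu" and ?Js = "Jstar Ua Wa P g al"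
  let ?Y = "(?T ^^ (H - 1)) X" and ?e = "supnorm (\<lambda>s. X s - Jstar Ua Wa P g al s)"
  let ?D = "\<lambda>t. (?Tp ^^ m) ?Y t - J t"
  have al: "0 < al" "al < 1" using game by (auto simp: markov_game_def)
  have dFV0: "0 \<le> dFV" using matnorm_inf_nonneg dFV by (rule order_trans)
  note dist = dist_Jpol_le[OF game pol H greedy]
  have "\<bar>Mop Phi S ?D s\<bar> \<le> matnorm_inf (Mmat Phi S) * supnorm ?D" by (rule abs_Mop_le)
  also have "\<dots> \<le> dFV * (al ^ m * ((1 + al) * al ^ (H - 1) / (1 - al) * ?e))"
  proof (intro mult_mono dFV dFV0 supnorm_nonneg)
    have "supnorm ?D \<le> al ^ m * supnorm (\<lambda>s. ?Y s - J s)"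
      unfolding J_def
      by (rule sup_contraction_funpow_fixed[OF Tpol_contraction[OF game pol] Tpol_Jpol[OF game pol]])
    also have "\<dots> \<le> al ^ m * ((1 + al) * al ^ (H - 1) / (1 - al) * ?e)"
      unfolding J_def using al by (intro mult_left_mono dist) auto
    finally show "supnorm ?D \<le> al ^ m * ((1 + al) * al ^ (H - 1) / (1 - al) * ?e)" .
  qed
  finally have 1: "\<bar>Mop Phi S ?D s\<bar> \<le> dFV * (al ^ m * ((1 + al) * al ^ (H - 1) / (1 - al) * ?e))" .
  have 2: "\<bar>J s - ?Js s\<bar> \<le> (al ^ (H - 1) + (1 + al) * al ^ (H - 1) / (1 - al)) * ?e"
    unfolding J_def by (rule order_trans[OF abs_le_supnorm[of "\<lambda>s. Jpol Ua Wa P g al mu nu s - ?Js s"] dist(2)])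
  have "\<bar>Mop Phi S ?D s + (J s - ?Js s)\<bar> \<le> dFV * (al ^ m * ((1 + al) * al ^ (H - 1) / (1 - al) * ?e))
     + (al ^ (H - 1) + (1 + al) * al ^ (H - 1) / (1 - al)) * ?e"
    using 1 2 by linarith
  also have "\<dots> = (al ^ (H - 1) + (1 + al) * ((1 + al ^ m * dFV) * al ^ (H - 1)) / (1 - al)) * ?e"
    using al by (simp add: divide_simps) (simp add: algebra_simps)
  finally show ?thesis .
qed

section \<open>Convergence of square-integrable martingales\<close>

text \<open>Orthogonality to all square-integrable functions of the past replaces the vanishing of the
  conditional expectation: it survives multiplication by indicators of past events.\<close>
definition L2_mart_diff :: "'w measure \<Rightarrow> (nat \<Rightarrow> 'w measure) \<Rightarrow> (nat \<Rightarrow> 'w \<Rightarrow> real) \<Rightarrow> bool" where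
  "L2_mart_diff M F d \<longleftrightarrow>
     (\<forall>k. d k \<in> borel_measurable (F (Suc k)) \<and> integrable M (\<lambda>\<omega>. (d k \<omega>)\<^sup>2)) \<and>
     (\<forall>k Y. Y \<in> borel_measurable (F k) \<longrightarrow> integrable M (\<lambda>\<omega>. (Y \<omega>)\<^sup>2) \<longrightarrow>
        (\<integral>\<omega>. Y \<omega> * d k \<omega> \<partial>M) = 0)"

definition filtered :: "'w measure \<Rightarrow> (nat \<Rightarrow> 'w measure) \<Rightarrow> bool" where
  "filtered M F \<longleftrightarrow> (\<forall>k. subalgebra M (F k)) \<and> (\<forall>k. sets (F k) \<subseteq> sets (F (Suc k)))"

lemma filtered_measurable_mono:
  assumes "filtered M F" and "j \<le> k" and "Y \<in> borel_measurable (F j)"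
  shows "Y \<in> borel_measurable (F k)"
proof -
  have "sets (F j) \<subseteq> sets (F k)"
    using assms(1) by (intro lift_Suc_mono_le[OF _ assms(2), of "\<lambda>k. sets (F k)"]) (auto simp: filtered_def)
  then have "subalgebra (F k) (F j)" using assms(1) by (simp add: filtered_def subalgebra_def)
  then show ?thesis using assms(3) by (rule measurable_from_subalg)
qed

lemma filtered_measurable:
  assumes "filtered M F" and "Y \<in> borel_measurable (F j)"
  shows "Y \<in> borel_measurable M"
  using assms(1) by (intro measurable_from_subalg[OF _ assms(2)]) (auto simp: filtered_def)

lemma integrable_mult_L2:
  fixes f g :: "'w \<Rightarrow> real"
  assumes [measurable]: "f \<in> borel_measurable M" "g \<in> borel_measurable M"
    and "integrable M (\<lambda>x. (f x)\<^sup>2)" "integrable M (\<lambda>x. (g x)\<^sup>2)"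
  shows "integrable M (\<lambda>x. f x * g x)"
proof (rule Bochner_Integration.integrable_bound)
  show "integrable M (\<lambda>x. (f x)\<^sup>2 + (g x)\<^sup>2)" using assms by simp
  have "norm (f x * g x) \<le> norm ((f x)\<^sup>2 + (g x)\<^sup>2)" for x
    using sum_squares_bound[of "\<bar>f x\<bar>" "\<bar>g x\<bar>"] mult_nonneg_nonneg[of "\<bar>f x\<bar>" "\<bar>g x\<bar>"]
    unfolding real_norm_def abs_mult by (simp only: power2_abs abs_ge_zero)
  then show "AE x in M. norm (f x * g x) \<le> norm ((f x)\<^sup>2 + (g x)\<^sup>2)" by simp
qed simp

lemma integrable_add_L2:
  fixes f g :: "'w \<Rightarrow> real"
  assumes "f \<in> borel_measurable M" "g \<in> borel_measurable M"
    and "integrable M (\<lambda>x. (f x)\<^sup>2)" "integrable M (\<lambda>x. (g x)\<^sup>2)"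
  shows "integrable M (\<lambda>x. (f x + g x)\<^sup>2)"
  using assms integrable_mult_L2[OF assms] by (simp add: power2_sum mult.assoc)

text \<open>The three claims are proved in one induction: measurability and square integrability of
  the partial sum up to \<open>n\<close> make it an admissible test function for \<open>d n\<close>,
  so the cross term vanishes and the variances add.\<close>

lemma L2_mart_diff_sum:
  assumes "filtered M F" and d: "L2_mart_diff M F d"
  shows "(\<lambda>\<omega>. \<Sum>k<n. d k \<omega>) \<in> borel_measurable (F n)"
    and "integrable M (\<lambda>\<omega>. (\<Sum>k<n. d k \<omega>)\<^sup>2)"
    and "(\<integral>\<omega>. (\<Sum>k<n. d k \<omega>)\<^sup>2 \<partial>M) = (\<Sum>k<n. \<integral>\<omega>. (d k \<omega>)\<^sup>2 \<partial>M)"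
proof (induction n)
  case (Suc n)
  let ?S = "\<lambda>\<omega>. \<Sum>k<n. d k \<omega>"
  have meas: "?S \<in> borel_measurable (F n)" "d n \<in> borel_measurable (F (Suc n))"
    using Suc d by (auto simp: L2_mart_diff_def)
  then have M: "?S \<in> borel_measurable M" "d n \<in> borel_measurable M"
    using filtered_measurable[OF assms(1)] by auto
  have int: "integrable M (\<lambda>\<omega>. (?S \<omega>)\<^sup>2)" "integrable M (\<lambda>\<omega>. (d n \<omega>)\<^sup>2)"
    using Suc d by (auto simp: L2_mart_diff_def)
  have orth: "(\<integral>\<omega>. ?S \<omega> * d n \<omega> \<partial>M) = 0"
    using d meas(1) int(1) by (auto simp: L2_mart_diff_def)
  { case 1
    have "?S \<in> borel_measurable (F (Suc n))"
      by (rule filtered_measurable_mono[OF assms(1) _ meas(1)]) simp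
    with meas(2) show ?case by simp }
  { case 2
    show ?case using integrable_add_L2[OF M int] by simp }
  { case 3
    have "(\<integral>\<omega>. (\<Sum>k<Suc n. d k \<omega>)\<^sup>2 \<partial>M) = (\<integral>\<omega>. (?S \<omega>)\<^sup>2 + (d n \<omega>)\<^sup>2 + 2 * (?S \<omega> * d n \<omega>) \<partial>M)"
      by (simp add: power2_sum mult.assoc)
    also have "\<dots> = (\<integral>\<omega>. (?S \<omega>)\<^sup>2 \<partial>M) + (\<integral>\<omega>. (d n \<omega>)\<^sup>2 \<partial>M) + 2 * (\<integral>\<omega>. ?S \<omega> * d n \<omega> \<partial>M)"
      using int integrable_mult_L2[OF M int] by simp
    finally show ?case using orth Suc by simp }
qed simp_all

text \<open>Kolmogorov's inequality. Stopping multiplies each difference by the indicator of a past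
  event, which keeps orthogonality and can only lower the variance.\<close>

lemma (in prob_space) martingale_maximal_inequality:
  assumes filt: "filtered M F" and d: "L2_mart_diff M F d" and eps: "eps > 0"
  shows "prob {\<omega>\<in>space M. \<exists>k\<le>n. eps \<le> \<bar>\<Sum>i<k. d i \<omega>\<bar>} \<le> (\<Sum>k<n. \<integral>\<omega>. (d k \<omega>)\<^sup>2 \<partial>M) / eps\<^sup>2"
proof -
  define S where "S n \<omega> = (\<Sum>i<n. d i \<omega>)" for n \<omega>
  define A where "A k = {\<omega>\<in>space M. \<forall>j\<le>k. \<bar>S j \<omega>\<bar> < eps}" for k
  \<comment> \<open>the differences stopped when the partial sums first reach \<open>eps\<close>; once this has happened,
    the stopped sum stays above \<open>eps\<close>, so that Chebyshev's inequality applies to it\<close>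
  define d' where "d' k \<omega> = indicator (A k) \<omega> * d k \<omega>" for k \<omega>
  define S' where "S' n \<omega> = (\<Sum>i<n. d' i \<omega>)" for n \<omega>
  have SF: "S j \<in> borel_measurable (F k)" if "j \<le> k" for j k
    using filtered_measurable_mono[OF filt that L2_mart_diff_sum(1)[OF filt d]]
    by (simp add: S_def[abs_def])
  have [measurable]: "S j \<in> borel_measurable M" for j
    using filtered_measurable[OF filt SF[OF order_refl]] .
  have AF: "A k \<in> sets (F k)" for k
  proof -
    have "space M = space (F k)" using filt by (simp add: filtered_def subalgebra_def)
    then have "A k = (\<Inter>j\<in>{..k}. {\<omega>\<in>space (F k). \<bar>S j \<omega>\<bar> < eps})" by (auto simp: A_def)
    also have "\<dots> \<in> sets (F k)"
    proof (rule sets.finite_INT)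
      fix j assume "j \<in> {..k}"
      then have [measurable]: "S j \<in> borel_measurable (F k)" using SF by simp
      show "{\<omega>\<in>space (F k). \<bar>S j \<omega>\<bar> < eps} \<in> sets (F k)" by measurable
    qed auto
    finally show ?thesis .
  qed
  have AM [measurable]: "A k \<in> sets M" for k
    using AF[of k] filt by (auto simp: filtered_def subalgebra_def)
  have dF: "d k \<in> borel_measurable (F (Suc k))" for k using d by (auto simp: L2_mart_diff_def)
  have [measurable]: "d k \<in> borel_measurable M" for k using filtered_measurable[OF filt dF] .
  have d2: "integrable M (\<lambda>\<omega>. (d k \<omega>)\<^sup>2)" for k using d by (auto simp: L2_mart_diff_def)
  have ind_sq: "(indicator (A k) \<omega> * x)\<^sup>2 \<le> x\<^sup>2" for k \<omega> and x :: real
    by (auto simp: indicator_def)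
  have d': "L2_mart_diff M F d'"
    unfolding L2_mart_diff_def
  proof (intro conjI allI impI)
    fix k
    have "indicator (A k) \<in> borel_measurable (F (Suc k))" (is "?f \<in> _")
      by (rule filtered_measurable_mono[OF filt, of k]) (use AF[of k] in auto)
    then show "d' k \<in> borel_measurable (F (Suc k))"
      unfolding d'_def[abs_def] using dF by (intro borel_measurable_times)
    show "integrable M (\<lambda>\<omega>. (d' k \<omega>)\<^sup>2)"
      by (rule Bochner_Integration.integrable_bound[OF d2[of k]]) (auto simp: d'_def[abs_def] ind_sq)
    fix Y :: "'a \<Rightarrow> real" assume Y: "Y \<in> borel_measurable (F k)" "integrable M (\<lambda>\<omega>. (Y \<omega>)\<^sup>2)"
    have [measurable]: "Y \<in> borel_measurable M" using filtered_measurable[OF filt Y(1)] .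
    \<comment> \<open>The indicator of \<open>A k\<close> is moved from the difference to the test
      function, which stays measurable with respect to \<open>F k\<close>.\<close>
    have "(\<lambda>\<omega>. indicator (A k) \<omega> * Y \<omega>) \<in> borel_measurable (F k)"
      using Y(1) AF[of k] by (intro borel_measurable_times) auto
    moreover have "integrable M (\<lambda>\<omega>. (indicator (A k) \<omega> * Y \<omega>)\<^sup>2)"
      by (rule Bochner_Integration.integrable_bound[OF Y(2)]) (auto simp: ind_sq)
    ultimately have "(\<integral>\<omega>. (indicator (A k) \<omega> * Y \<omega>) * d k \<omega> \<partial>M) = 0"
      using d by (auto simp: L2_mart_diff_def)
    then show "(\<integral>\<omega>. Y \<omega> * d' k \<omega> \<partial>M) = 0" by (simp add: d'_def mult_ac)
  qed
  \<comment> \<open>Only the sums strictly before \<open>n\<close> must stay below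
    \<open>eps\<close>: the increment that causes the crossing is still included in
    \<open>S'\<close>.\<close>
  have S'_eq: "S' n \<omega> = S n \<omega>" if "\<omega> \<in> space M" "\<forall>k<n. \<bar>S k \<omega>\<bar> < eps" for n \<omega>
    unfolding S'_def S_def d'_def by (rule sum.cong) (use that in \<open>auto simp: A_def indicator_def\<close>)
  have S'_ge: "eps \<le> \<bar>S' n \<omega>\<bar>" if "\<omega> \<in> space M" "\<exists>k\<le>n. eps \<le> \<bar>S k \<omega>\<bar>" for n \<omega>
    using that(2)
  proof (induction n)
    case 0 then show ?case by (simp add: S'_def S_def)
  next
    case (Suc n)
    show ?case
    proof (cases "\<exists>k\<le>n. eps \<le> \<bar>S k \<omega>\<bar>")
      case True
      \<comment> \<open>After a crossing all later indicators vanish, so the stopped sum is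
        frozen.\<close>
      then have "\<omega> \<notin> A n" by (auto simp: A_def not_less)
      then have "S' (Suc n) \<omega> = S' n \<omega>" by (simp add: S'_def d'_def)
      then show ?thesis using Suc.IH True by simp
    next
      case False
      then have "S' (Suc n) \<omega> = S (Suc n) \<omega>"
        by (intro S'_eq that(1)) (meson not_le less_Suc_eq_le)
      moreover have "eps \<le> \<bar>S (Suc n) \<omega>\<bar>" using False Suc.prems le_Suc_eq by auto
      ultimately show ?thesis by simp
    qed
  qed
  note S'L = L2_mart_diff_sum[OF filt d', of n, folded S'_def]
  have [measurable]: "S' n \<in> borel_measurable M"
    using filtered_measurable[OF filt L2_mart_diff_sum(1)[OF filt d']] by (simp add: S'_def[abs_def])
  have "prob {\<omega>\<in>space M. \<exists>k\<le>n. eps \<le> \<bar>S k \<omega>\<bar>} \<le> prob {\<omega>\<in>space M. eps\<^sup>2 \<le> (S' n \<omega>)\<^sup>2}"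
  proof (rule finite_measure_mono)
    show "{\<omega>\<in>space M. \<exists>k\<le>n. eps \<le> \<bar>S k \<omega>\<bar>} \<subseteq> {\<omega>\<in>space M. eps\<^sup>2 \<le> (S' n \<omega>)\<^sup>2}"
    proof safe
      fix \<omega> k assume "\<omega> \<in> space M" "k \<le> n" "eps \<le> \<bar>S k \<omega>\<bar>"
      then have "eps \<le> \<bar>S' n \<omega>\<bar>" using S'_ge by blast
      then show "eps\<^sup>2 \<le> (S' n \<omega>)\<^sup>2" using eps by (metis less_imp_le power2_abs power_mono)
    qed
  qed measurable
  also have "\<dots> \<le> (\<integral>\<omega>. (S' n \<omega>)\<^sup>2 \<partial>M) / eps\<^sup>2"
    using S'L(2) eps by (intro integral_Markov_inequality_measure[where A="{}"]) auto
  also have "\<dots> = (\<Sum>k<n. \<integral>\<omega>. (d' k \<omega>)\<^sup>2 \<partial>M) / eps\<^sup>2" using S'L(3) by simp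
  also have "\<dots> \<le> (\<Sum>k<n. \<integral>\<omega>. (d k \<omega>)\<^sup>2 \<partial>M) / eps\<^sup>2"
    using d' d2 by (intro divide_right_mono sum_mono integral_mono)
      (auto simp: L2_mart_diff_def d'_def ind_sq)
  finally show ?thesis by (simp add: S_def)
qed

text \<open>The maximal inequality for the differences from index \<open>a\<close> on bounds the
  probability of any later excursion of size \<open>e\<close> by a tail of a convergent series.
  Almost every path is therefore Cauchy.\<close>

lemma (in prob_space) L2_martingale_convergence:
  assumes filt: "filtered M F" and d: "L2_mart_diff M F d"
    and summ: "summable (\<lambda>k. \<integral>\<omega>. (d k \<omega>)\<^sup>2 \<partial>M)"
  shows "AE \<omega> in M. convergent (\<lambda>n. \<Sum>k<n. d k \<omega>)"
proof -
  let ?v = "\<lambda>k. \<integral>\<omega>. (d k \<omega>)\<^sup>2 \<partial>M"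
  have [measurable]: "d k \<in> borel_measurable M" for k
    using filtered_measurable[OF filt, of "d k" "Suc k"] d by (auto simp: L2_mart_diff_def)
  have tail: "AE \<omega> in M. \<exists>a. \<forall>n. \<bar>\<Sum>i<n. d (i + a) \<omega>\<bar> < e" if e: "e > 0" for e
  proof -
    define B where "B a n = {\<omega>\<in>space M. \<exists>k\<le>n. e \<le> \<bar>\<Sum>i<k. d (i + a) \<omega>\<bar>}" for a n
    have [measurable]: "B a n \<in> sets M" for a n unfolding B_def by measurable
    \<comment> \<open>The finite-horizon bound for the shifted martingale passes to the infinite
      horizon by continuity of the measure along the increasing events \<open>B a n\<close>.\<close>
    have Ba: "prob (\<Union>n. B a n) \<le> (\<Sum>i. ?v (i + a)) / e\<^sup>2" for a
    proof (rule LIMSEQ_le_const2)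
      show "(\<lambda>n. prob (B a n)) \<longlonglongrightarrow> prob (\<Union>n. B a n)"
        by (rule finite_Lim_measure_incseq) (auto simp: incseq_def B_def intro: order_trans)
      have "filtered M (\<lambda>i. F (i + a))" using filt by (auto simp: filtered_def)
      moreover have "L2_mart_diff M (\<lambda>i. F (i + a)) (\<lambda>i. d (i + a))"
        using d by (auto simp: L2_mart_diff_def)
      ultimately have "prob (B a n) \<le> (\<Sum>k<n. ?v (k + a)) / e\<^sup>2" for n
        unfolding B_def using e by (rule martingale_maximal_inequality)
      also have "(\<Sum>k<n. ?v (k + a)) / e\<^sup>2 \<le> (\<Sum>i. ?v (i + a)) / e\<^sup>2" for n
        using summable_ignore_initial_segment[OF summ, of a]
        by (intro divide_right_mono sum_le_suminf) auto
      finally show "\<exists>N. \<forall>n\<ge>N. prob (B a n) \<le> (\<Sum>i. ?v (i + a)) / e\<^sup>2" by blast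
    qed
    \<comment> \<open>A bad path makes an excursion after every starting index \<open>a\<close>; the
      probability of this event lies below all tails and so is zero.\<close>
    have "prob (\<Inter>a. \<Union>n. B a n) \<le> (\<Sum>i. ?v (i + a)) / e\<^sup>2" for a
      by (rule order_trans[OF finite_measure_mono Ba[of a]]) auto
    moreover have "(\<lambda>a. (\<Sum>i. ?v (i + a)) / e\<^sup>2) \<longlonglongrightarrow> 0 / e\<^sup>2"
      using e by (intro tendsto_divide tendsto_const suminf_exist_split2[OF summ]) auto
    ultimately have "prob (\<Inter>a. \<Union>n. B a n) \<le> 0"
      using LIMSEQ_le_const by fastforce
    then have "prob (\<Inter>a. \<Union>n. B a n) = 0" by (simp add: measure_le_0_iff)
    moreover have "(\<Inter>a. \<Union>n. B a n) \<in> sets M" by measurable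
    ultimately have "(\<Inter>a. \<Union>n. B a n) \<in> null_sets M"
      by (simp add: null_sets_def emeasure_eq_measure)
    then show ?thesis
      by (rule AE_I') (fastforce simp: B_def not_less)
  qed
  \<comment> \<open>Countably many tolerances suffice, so a single null set serves all of
    them.\<close>
  have "AE \<omega> in M. \<forall>j. \<exists>a. \<forall>n. \<bar>\<Sum>i<n. d (i + a) \<omega>\<bar> < 1 / real (Suc j)"
    unfolding AE_all_countable by (intro allI tail) simp
  then show ?thesis
  proof eventually_elim
    case (elim \<omega>)
    have "Cauchy (\<lambda>n. \<Sum>k<n. d k \<omega>)"
    proof (rule metric_CauchyI)
      fix e :: real assume "0 < e"
      then obtain j where j: "1 / real (Suc j) < e / 2" using nat_approx_posE[of "e / 2"] by auto
      obtain a where a: "\<And>n. \<bar>\<Sum>i<n. d (i + a) \<omega>\<bar> < 1 / real (Suc j)" using elim by blast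
      have near: "\<bar>(\<Sum>k<n. d k \<omega>) - (\<Sum>k<a. d k \<omega>)\<bar> < e / 2" if "n \<ge> a" for n
      proof -
        have "(\<Sum>k<n. d k \<omega>) - (\<Sum>k<a. d k \<omega>) = (\<Sum>i<n - a. d (i + a) \<omega>)"
        proof -
          have "(\<Sum>k<m + a. d k \<omega>) = (\<Sum>k<a. d k \<omega>) + (\<Sum>i<m. d (i + a) \<omega>)" for m
            by (induction m) auto
          from this[of "n - a"] show ?thesis using that by simp
        qed
        then show ?thesis using a[of "n - a"] j by simp
      qed
      have "dist (\<Sum>k<n. d k \<omega>) (\<Sum>k<n'. d k \<omega>) < e" if "n \<ge> a" "n' \<ge> a" for n n'
        using near[OF that(1)] near[OF that(2)] by (simp add: dist_real_def abs_if split: if_splits)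
      then show "\<exists>a. \<forall>n\<ge>a. \<forall>n'\<ge>a. dist (\<Sum>k<n. d k \<omega>) (\<Sum>k<n'. d k \<omega>) < e" by blast
    qed
    then show ?case by (rule Cauchy_convergent)
  qed
qed

section \<open>Contractive stochastic approximation\<close>

text \<open>For a level \<open>L\<close> strictly between \<open>d / c\<close> and \<open>e\<close>,
  the excess \<open>u - L\<close> is eventually bounded by a recursion with factors
  \<open>1 - c * gamma k\<close>. Their product is at most the exponential of \<open>- c\<close>
  times a divergent sum, so the upper bound on the excess tends to zero.\<close>

lemma scalar_recursion_limsup:
  fixes u eps gamma :: "nat \<Rightarrow> real"
  assumes c: "0 < c" and gamma0: "\<And>k. 0 \<le> gamma k" and div: "\<not> summable gamma"
    and small: "\<forall>\<^sub>F k in sequentially. c * gamma k \<le> 1"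
    and rec: "\<forall>\<^sub>F k in sequentially. u (Suc k) \<le> (1 - c * gamma k) * u k + gamma k * eps k"
    and eps: "eps \<longlonglongrightarrow> d" and e: "d / c < e"
  shows "\<forall>\<^sub>F k in sequentially. u k < e"
proof -
  define L where "L = (d / c + e) / 2"
  have L: "d < c * L" "L < e" using c e by (auto simp: L_def field_simps)
  have "\<forall>\<^sub>F k in sequentially. u (Suc k) - L \<le> (1 - c * gamma k) * (u k - L) \<and> c * gamma k \<le> 1"
    using rec small order_tendstoD(2)[OF eps L(1)]
  proof eventually_elim
    case (elim k)
    have "gamma k * eps k \<le> gamma k * (c * L)" using elim gamma0 by (intro mult_left_mono) auto
    then show ?case using elim by (simp add: algebra_simps)
  qed
  then obtain K where K: "\<And>k. k \<ge> K \<Longrightarrow> u (Suc k) - L \<le> (1 - c * gamma k) * (u k - L)"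
    "\<And>k. k \<ge> K \<Longrightarrow> c * gamma k \<le> 1"
    unfolding eventually_sequentially by blast
  \<comment> \<open>The positive part is taken because replacing a factor by its exponential bound
    needs a nonnegative multiplicand.\<close>
  define B where "B = max 0 (u K - L)"
  have bnd: "u (K + n) - L \<le> B * exp (- c * (\<Sum>i<n. gamma (K + i)))" for n
  proof (induction n)
    case (Suc n)
    have "u (K + Suc n) - L \<le> (1 - c * gamma (K + n)) * (u (K + n) - L)"
      using K(1)[of "K + n"] by simp
    also have "\<dots> \<le> (1 - c * gamma (K + n)) * (B * exp (- c * (\<Sum>i<n. gamma (K + i))))"
      using K(2)[of "K + n"] Suc by (intro mult_left_mono) auto
    also have "\<dots> \<le> exp (- c * gamma (K + n)) * (B * exp (- c * (\<Sum>i<n. gamma (K + i))))"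
      using exp_ge_add_one_self[of "- c * gamma (K + n)"] by (intro mult_right_mono) (auto simp: B_def)
    finally show ?case by (simp add: exp_add[symmetric] algebra_simps)
  qed (simp add: B_def)
  have div': "\<not> summable (\<lambda>i. gamma (K + i))"
    using div summable_iff_shift[of gamma K] by (simp add: add.commute)
  have "filterlim (\<lambda>n. \<Sum>i<n. gamma (K + i)) at_top sequentially"
    unfolding filterlim_at_top
  proof
    fix Z
    \<comment> \<open>Otherwise \<open>Z\<close> would bound all partial sums of a nonnegative
      series, which would then be summable.\<close>
    obtain N where N: "Z < (\<Sum>i<N. gamma (K + i))"
      using div' summableI_nonneg_bounded[of "\<lambda>i. gamma (K + i)" Z] gamma0 by (meson not_le)
    have "Z \<le> (\<Sum>i<n. gamma (K + i))" if "n \<ge> N" for n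
      using N sum_mono2[of "{..<n}" "{..<N}" "\<lambda>i. gamma (K + i)"] that gamma0 by force
    then show "\<forall>\<^sub>F n in sequentially. Z \<le> (\<Sum>i<n. gamma (K + i))"
      by (rule eventually_sequentiallyI)
  qed
  then have "(\<lambda>n. B * exp (- c * (\<Sum>i<n. gamma (K + i)))) \<longlonglongrightarrow> B * 0"
    using c by (intro tendsto_mult tendsto_const filterlim_compose[OF exp_at_bot]
       filterlim_tendsto_neg_mult_at_bot[of _ "- c"]) auto
  then have "\<forall>\<^sub>F n in sequentially. B * exp (- c * (\<Sum>i<n. gamma (K + i))) < e - L"
    using L by (intro order_tendstoD(2)) auto
  then have "\<forall>\<^sub>F n in sequentially. u (n + K) < e"
  proof eventually_elim
    case (elim n) then show ?case using bnd[of n] by (simp add: add.commute)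
  qed
  then show ?thesis using eventually_sequentially_seg[of "\<lambda>n. u n < e" K] by simp
qed

text \<open>Provides the three ingredients of a square-integrable martingale difference. The last
  one moves the past factor \<open>Y\<close> inside the conditional expectation. The constant 4
  combines \<open>(a - b)^2 \<le> 2 * a^2 + 2 * b^2\<close> with Jensen's inequality; a crude bound
  is enough for summability.\<close>

lemma (in prob_space) cond_exp_residual:
  fixes Z :: "'a \<Rightarrow> real"
  assumes sub: "subalgebra M G" and Z [measurable]: "Z \<in> borel_measurable M"
    and Z2: "integrable M (\<lambda>\<omega>. (Z \<omega>)\<^sup>2)"
  defines "r \<equiv> \<lambda>\<omega>. Z \<omega> - real_cond_exp M G Z \<omega>"
  shows "integrable M (\<lambda>\<omega>. (r \<omega>)\<^sup>2)"
    and "(\<integral>\<omega>. (r \<omega>)\<^sup>2 \<partial>M) \<le> 4 * (\<integral>\<omega>. (Z \<omega>)\<^sup>2 \<partial>M)"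
    and "\<And>Y. Y \<in> borel_measurable G \<Longrightarrow> integrable M (\<lambda>\<omega>. (Y \<omega>)\<^sup>2) \<Longrightarrow> (\<integral>\<omega>. Y \<omega> * r \<omega> \<partial>M) = 0"
proof -
  interpret G: finite_measure_subalgebra M G
    by unfold_locales (rule sub)
  let ?E = "real_cond_exp M G"
  have [measurable]: "r \<in> borel_measurable M" unfolding r_def by simp
  have Z1: "integrable M Z" by (rule square_integrable_imp_integrable[OF Z Z2])
  have jensen: "AE \<omega> in M. (?E Z \<omega>)\<^sup>2 \<le> ?E (\<lambda>\<omega>. (Z \<omega>)\<^sup>2) \<omega>"
    by (rule G.real_cond_exp_jensens_inequality(2)[where I = UNIV and q = "\<lambda>x. x\<^sup>2"])
      (auto intro: Z1 Z2 convex_power2)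
  have EZ2: "integrable M (?E (\<lambda>\<omega>. (Z \<omega>)\<^sup>2))" by (rule G.real_cond_exp_int(1)[OF Z2])
  have E2: "integrable M (\<lambda>\<omega>. (?E Z \<omega>)\<^sup>2)"
    by (rule Bochner_Integration.integrable_bound[OF EZ2]) (use jensen in auto)
  \<comment> \<open>The difference of the two sides is the square of \<open>Z + E Z\<close>, with
    \<open>E Z\<close> the conditional expectation.\<close>
  have bnd: "(r \<omega>)\<^sup>2 \<le> 2 * (Z \<omega>)\<^sup>2 + 2 * (?E Z \<omega>)\<^sup>2" for \<omega>
    using sum_squares_ge_zero[of "Z \<omega> + ?E Z \<omega>" 0]
    unfolding r_def by (simp add: power2_eq_square algebra_simps)
  show r2: "integrable M (\<lambda>\<omega>. (r \<omega>)\<^sup>2)"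
    by (rule Bochner_Integration.integrable_bound[of _ "\<lambda>\<omega>. 2 * (Z \<omega>)\<^sup>2 + 2 * (?E Z \<omega>)\<^sup>2"])
      (use Z2 E2 bnd in auto)
  have "(\<integral>\<omega>. (r \<omega>)\<^sup>2 \<partial>M) \<le> (\<integral>\<omega>. 2 * (Z \<omega>)\<^sup>2 + 2 * (?E Z \<omega>)\<^sup>2 \<partial>M)"
    using r2 Z2 E2 bnd by (intro integral_mono) auto
  also have "\<dots> = 2 * (\<integral>\<omega>. (Z \<omega>)\<^sup>2 \<partial>M) + 2 * (\<integral>\<omega>. (?E Z \<omega>)\<^sup>2 \<partial>M)"
    using Z2 E2 by simp
  also have "(\<integral>\<omega>. (?E Z \<omega>)\<^sup>2 \<partial>M) \<le> (\<integral>\<omega>. ?E (\<lambda>\<omega>. (Z \<omega>)\<^sup>2) \<omega> \<partial>M)"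
    using E2 EZ2 jensen by (rule integral_mono_AE)
  also have "\<dots> = (\<integral>\<omega>. (Z \<omega>)\<^sup>2 \<partial>M)" by (rule G.real_cond_exp_int(2)[OF Z2])
  finally show "(\<integral>\<omega>. (r \<omega>)\<^sup>2 \<partial>M) \<le> 4 * (\<integral>\<omega>. (Z \<omega>)\<^sup>2 \<partial>M)" by simp
  fix Y :: "'a \<Rightarrow> real"
  assume Y: "Y \<in> borel_measurable G" "integrable M (\<lambda>\<omega>. (Y \<omega>)\<^sup>2)"
  have YZ: "integrable M (\<lambda>\<omega>. Y \<omega> * Z \<omega>)"
    by (rule integrable_mult_L2[OF measurable_from_subalg[OF sub Y(1)] Z Y(2) Z2])
  have "(\<integral>\<omega>. Y \<omega> * r \<omega> \<partial>M) = (\<integral>\<omega>. Y \<omega> * Z \<omega> \<partial>M) - (\<integral>\<omega>. Y \<omega> * ?E Z \<omega> \<partial>M)"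
    using YZ G.real_cond_exp_intg(1)[OF YZ Y(1) Z] by (simp add: r_def right_diff_distrib)
  then show "(\<integral>\<omega>. Y \<omega> * r \<omega> \<partial>M) = 0"
    using G.real_cond_exp_intg(2)[OF YZ Y(1) Z] by simp
qed

text \<open>The deterministic part, to be applied on each path: \<open>a\<close> is the contracting
  drift, \<open>b\<close> the bounded bias, and the noise enters only through increments of a null
  sequence \<open>R\<close>.\<close>

lemma contractive_recursion_limsup:
  fixes x a b R :: "nat \<Rightarrow> 's::finite \<Rightarrow> real"
  assumes beta: "0 \<le> beta" "beta < 1"
    and gamma0: "\<And>k. 0 \<le> gamma k" and gamma_div: "\<not> summable gamma" and gamma_lim: "gamma \<longlonglongrightarrow> 0"
    and rec: "\<And>k s. x (Suc k) s = (1 - gamma k) * x k s + gamma k * (a k s + b k s) + (R (Suc k) s - R k s)"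
    and a: "\<And>k s. \<bar>a k s\<bar> \<le> beta * supnorm (x k)"
    and b: "\<And>k s. \<bar>b k s\<bar> \<le> delta"
    and R: "\<And>s. (\<lambda>k. R k s) \<longlonglongrightarrow> 0"
  shows "limsup (\<lambda>k. ereal (supnorm (x k))) \<le> ereal (delta / (1 - beta))"
proof -
  \<comment> \<open>subtracting the noise tail \<open>R\<close> leaves a recursion without noise\<close>
  define y where "y k s = x k s - R k s" for k s
  define u where "u k = supnorm (y k)" for k
  define r where "r k = supnorm (R k)" for k
  have r_lim: "r \<longlonglongrightarrow> 0" unfolding r_def[abs_def] by (rule supnorm_tendsto_0[OF R])
  have r0: "0 \<le> r k" for k by (simp add: r_def supnorm_nonneg)
  have x_le: "supnorm (x k) \<le> u k + r k" for k
  proof (rule supnorm_le)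
    fix s show "\<bar>x k s\<bar> \<le> u k + r k"
      using abs_le_supnorm[of "y k" s] abs_le_supnorm[of "R k" s]
      unfolding u_def r_def by (simp add: y_def)
  qed
  have gamma1: "\<forall>\<^sub>F k in sequentially. gamma k \<le> 1"
    using order_tendstoD(2)[OF gamma_lim, of 1] by (auto elim: eventually_mono)
  have u_rec: "u (Suc k) \<le> (1 - (1 - beta) * gamma k) * u k + gamma k * (delta + 2 * r k)"
    if "gamma k \<le> 1" for k
    unfolding u_def[of "Suc k"]
  proof (rule supnorm_le)
    fix s
    have "beta * supnorm (x k) \<le> beta * u k + r k"
    proof -
      have "beta * supnorm (x k) \<le> beta * (u k + r k)" using x_le beta by (intro mult_left_mono) auto
      also have "\<dots> \<le> beta * u k + 1 * r k"
        unfolding distrib_left using beta r0 by (intro add_left_mono mult_right_mono) auto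
      finally show ?thesis by simp
    qed
    \<comment> \<open>One \<open>r k\<close> comes from replacing \<open>x\<close> by
      \<open>y\<close> inside the drift, where \<open>beta < 1\<close>; the other is the forcing
      term \<open>- R k\<close> left by the substitution.\<close>
    then have e: "\<bar>a k s + b k s - R k s\<bar> \<le> beta * u k + delta + 2 * r k"
      using a[of k s] b[of k s] abs_le_supnorm[of "R k" s] unfolding r_def by linarith
    have "y (Suc k) s = (1 - gamma k) * y k s + gamma k * (a k s + b k s - R k s)"
      by (simp add: y_def rec algebra_simps)
    then have "\<bar>y (Suc k) s\<bar> \<le> (1 - gamma k) * \<bar>y k s\<bar> + gamma k * \<bar>a k s + b k s - R k s\<bar>"
      using abs_triangle_ineq[of "(1 - gamma k) * y k s" "gamma k * (a k s + b k s - R k s)"]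
        that gamma0[of k] by (simp add: abs_mult)
    also have "\<dots> \<le> (1 - gamma k) * u k + gamma k * (beta * u k + delta + 2 * r k)"
      using that gamma0[of k] e abs_le_supnorm[of "y k" s]
      by (intro add_mono mult_left_mono) (auto simp: u_def)
    finally show "\<bar>y (Suc k) s\<bar> \<le> (1 - (1 - beta) * gamma k) * u k + gamma k * (delta + 2 * r k)"
      by (simp add: algebra_simps)
  qed
  have ev: "\<forall>\<^sub>F k in sequentially. supnorm (x k) < e" if e: "delta / (1 - beta) < e" for e
  proof -
    \<comment> \<open>The intermediate level leaves the margin \<open>e - e'\<close> for the return
      from \<open>y\<close> to \<open>x\<close>.\<close>
    obtain e' where e': "delta / (1 - beta) < e'" "e' < e" using dense[OF e] by blast
    have "\<forall>\<^sub>F k in sequentially. u k < e'"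
    proof (rule scalar_recursion_limsup)
      show "\<forall>\<^sub>F k in sequentially. (1 - beta) * gamma k \<le> 1"
        using gamma1
      proof eventually_elim
        case (elim k)
        then have "(1 - beta) * gamma k \<le> 1 * 1" using beta gamma0 by (intro mult_mono) auto
        then show ?case by simp
      qed
      show "\<forall>\<^sub>F k in sequentially. u (Suc k) \<le> (1 - (1 - beta) * gamma k) * u k + gamma k * (delta + 2 * r k)"
        using gamma1 by (rule eventually_mono) (rule u_rec)
      have "(\<lambda>k. delta + 2 * r k) \<longlonglongrightarrow> delta + 2 * 0"
        by (intro tendsto_intros r_lim)
      then show "(\<lambda>k. delta + 2 * r k) \<longlonglongrightarrow> delta" by simp
      show "delta / (1 - beta) < e'" by (rule e')
    qed (use beta gamma0 gamma_div in auto)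
    moreover have "\<forall>\<^sub>F k in sequentially. r k < e - e'"
      using e' by (intro order_tendstoD(2)[OF r_lim]) simp
    ultimately show ?thesis
    proof eventually_elim
      case (elim k) then show ?case using x_le[of k] by linarith
    qed
  qed
  show ?thesis
    unfolding Limsup_le_iff
  proof (intro allI impI)
    fix z :: ereal assume "ereal (delta / (1 - beta)) < z"
    then show "\<forall>\<^sub>F k in sequentially. ereal (supnorm (x k)) < z"
      by (cases z) (use ev in auto)
  qed
qed

text \<open>The noise \<open>Z\<close> splits into its conditional mean, bounded by
  \<open>delta\<close>, and a centred part. Weighted by \<open>gamma\<close>, the centred part has
  variances at most \<open>4 * C * gamma^2\<close>, hence summable, so its sums converge almost
  surely; the deterministic recursion then applies to almost every path.\<close>

lemma (in prob_space) stochastic_contraction_limsup: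
  fixes x a Z :: "nat \<Rightarrow> 'a \<Rightarrow> 's::finite \<Rightarrow> real"
  assumes filt: "filtered M F"
    and beta: "0 \<le> beta" "beta < 1"
    and gamma0: "\<And>k. 0 \<le> gamma k" and gamma_div: "\<not> summable gamma"
    and gamma_sq: "summable (\<lambda>k. (gamma k)\<^sup>2)"
    and Z: "\<And>k s. (\<lambda>\<omega>. Z k \<omega> s) \<in> borel_measurable (F (Suc k))"
    and Z2: "\<And>k s. integrable M (\<lambda>\<omega>. (Z k \<omega> s)\<^sup>2)"
    and ZC: "\<And>k s. (\<integral>\<omega>. (Z k \<omega> s)\<^sup>2 \<partial>M) \<le> C"
    and bias: "\<And>k s. AE \<omega> in M. \<bar>real_cond_exp M (F k) (\<lambda>\<omega>. Z k \<omega> s) \<omega>\<bar> \<le> delta"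
    and rec: "\<And>k \<omega> s. \<omega> \<in> space M \<Longrightarrow>
        x (Suc k) \<omega> s = (1 - gamma k) * x k \<omega> s + gamma k * (a k \<omega> s + Z k \<omega> s)"
    and a: "\<And>k \<omega> s. \<omega> \<in> space M \<Longrightarrow> \<bar>a k \<omega> s\<bar> \<le> beta * supnorm (x k \<omega>)"
  shows "AE \<omega> in M. limsup (\<lambda>k. ereal (supnorm (x k \<omega>))) \<le> ereal (delta / (1 - beta))"
proof -
  define b where "b k \<omega> s = real_cond_exp M (F k) (\<lambda>\<omega>. Z k \<omega> s) \<omega>" for k \<omega> s
  define d where "d s k \<omega> = gamma k * (Z k \<omega> s - b k \<omega> s)" for s k \<omega>
  have sub: "subalgebra M (F k)" for k using filt by (simp add: filtered_def)
  have ZM: "(\<lambda>\<omega>. Z k \<omega> s) \<in> borel_measurable M" for k s by (rule filtered_measurable[OF filt Z])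
  have resid: "integrable M (\<lambda>\<omega>. (Z k \<omega> s - b k \<omega> s)\<^sup>2)"
    "(\<integral>\<omega>. (Z k \<omega> s - b k \<omega> s)\<^sup>2 \<partial>M) \<le> 4 * (\<integral>\<omega>. (Z k \<omega> s)\<^sup>2 \<partial>M)"
    "Y \<in> borel_measurable (F k) \<Longrightarrow> integrable M (\<lambda>\<omega>. (Y \<omega>)\<^sup>2) \<Longrightarrow>
       (\<integral>\<omega>. Y \<omega> * (Z k \<omega> s - b k \<omega> s) \<partial>M) = 0" for k s Y
    unfolding b_def by (rule cond_exp_residual[OF sub ZM Z2]; assumption)+
  have bF: "(\<lambda>\<omega>. b k \<omega> s) \<in> borel_measurable (F (Suc k))" for k s
    unfolding b_def by (rule filtered_measurable_mono[OF filt _ borel_measurable_cond_exp]) simp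
  have d_mart: "L2_mart_diff M F (d s)" for s
    unfolding L2_mart_diff_def
  proof (intro conjI allI impI)
    fix k
    show "d s k \<in> borel_measurable (F (Suc k))"
      unfolding d_def[abs_def] using Z bF by simp
    show "integrable M (\<lambda>\<omega>. (d s k \<omega>)\<^sup>2)"
      unfolding d_def power_mult_distrib by (intro integrable_mult_right resid(1))
    fix Y :: "'a \<Rightarrow> real" assume Y: "Y \<in> borel_measurable (F k)" "integrable M (\<lambda>\<omega>. (Y \<omega>)\<^sup>2)"
    have "(\<integral>\<omega>. Y \<omega> * d s k \<omega> \<partial>M) = gamma k * (\<integral>\<omega>. Y \<omega> * (Z k \<omega> s - b k \<omega> s) \<partial>M)"
      unfolding d_def mult.left_commute[of _ "gamma k"] by simp
    then show "(\<integral>\<omega>. Y \<omega> * d s k \<omega> \<partial>M) = 0" using resid(3)[OF Y] by simp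
  qed
  have d_summ: "summable (\<lambda>k. \<integral>\<omega>. (d s k \<omega>)\<^sup>2 \<partial>M)" for s
  proof (rule summable_comparison_test')
    show "summable (\<lambda>k. (gamma k)\<^sup>2 * (4 * C))" using gamma_sq by (rule summable_mult2)
    fix k
    have "(\<integral>\<omega>. (d s k \<omega>)\<^sup>2 \<partial>M) = (gamma k)\<^sup>2 * (\<integral>\<omega>. (Z k \<omega> s - b k \<omega> s)\<^sup>2 \<partial>M)"
      unfolding d_def power_mult_distrib by simp
    also have "\<dots> \<le> (gamma k)\<^sup>2 * (4 * C)"
    proof (rule mult_left_mono)
      have "(\<integral>\<omega>. (Z k \<omega> s - b k \<omega> s)\<^sup>2 \<partial>M) \<le> 4 * (\<integral>\<omega>. (Z k \<omega> s)\<^sup>2 \<partial>M)" by (rule resid(2))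
      also have "\<dots> \<le> 4 * C" using ZC by simp
      finally show "(\<integral>\<omega>. (Z k \<omega> s - b k \<omega> s)\<^sup>2 \<partial>M) \<le> 4 * C" .
    qed simp
    finally show "norm (\<integral>\<omega>. (d s k \<omega>)\<^sup>2 \<partial>M) \<le> (gamma k)\<^sup>2 * (4 * C)" by simp
  qed
  have "AE \<omega> in M. \<forall>s. convergent (\<lambda>n. \<Sum>k<n. d s k \<omega>)"
    unfolding AE_all_countable
    by (intro allI L2_martingale_convergence[OF filt d_mart d_summ])
  moreover have "AE \<omega> in M. \<forall>k s. \<bar>b k \<omega> s\<bar> \<le> delta"
    unfolding AE_all_countable b_def using bias by blast
  ultimately show ?thesis
    using AE_space
  proof eventually_elim
    case (elim \<omega>)
    then obtain S where S: "\<And>s. (\<lambda>n. \<Sum>k<n. d s k \<omega>) \<longlonglongrightarrow> S s"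
      unfolding convergent_def by metis
    show ?case
    \<comment> \<open>Partial sum minus limit tends to zero and has the increments
      \<open>d s k\<close>, so it can play the role of \<open>R\<close>.\<close>
    proof (rule contractive_recursion_limsup[where a = "\<lambda>k. a k \<omega>" and b = "\<lambda>k. b k \<omega>"
          and R = "\<lambda>n s. (\<Sum>k<n. d s k \<omega>) - S s"])
      \<comment> \<open>The squares tend to zero, and for nonnegative stepsizes the square root
        recovers \<open>gamma\<close>.\<close>
      show "gamma \<longlonglongrightarrow> 0"
        using tendsto_real_sqrt[OF summable_LIMSEQ_zero[OF gamma_sq]] by (simp add: gamma0)
      show "x (Suc k) \<omega> s = (1 - gamma k) * x k \<omega> s + gamma k * (a k \<omega> s + b k \<omega> s)
          + ((\<Sum>k<Suc k. d s k \<omega>) - S s - ((\<Sum>k<k. d s k \<omega>) - S s))" for k s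
        using elim by (simp add: rec d_def algebra_simps)
      show "(\<lambda>n. (\<Sum>k<n. d s k \<omega>) - S s) \<longlonglongrightarrow> 0" for s
        using S by (simp add: LIM_zero)
    qed (use beta gamma0 gamma_div elim a in auto)
  qed
qed

section \<open>The approximate policy iteration\<close>

lemma Tpol_funpow_measurable:
  assumes "\<And>s u. (\<lambda>\<omega>. mu \<omega> s u) \<in> borel_measurable G" "\<And>s v. (\<lambda>\<omega>. nu \<omega> s v) \<in> borel_measurable G"
  shows "(\<lambda>\<omega>. (Tpol Ua Wa P g al (mu \<omega>) (nu \<omega>) ^^ n) (\<lambda>_. 0) s) \<in> borel_measurable G"
proof (induction n arbitrary: s)
  case (Suc n)
  show ?case
    unfolding funpow.simps comp_def Tpol_def[of _ _ _ _ _ _ _ "(_ ^^ _) _"] Agame_def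
    using assms Suc
    by (intro borel_measurable_sum borel_measurable_times borel_measurable_add borel_measurable_const)
qed simp

text \<open>The value is given by a definite description; measurability comes from writing it as the
  limit of the iterates from zero, which are polynomials in the policy probabilities.\<close>

lemma Jpol_measurable:
  assumes game: "markov_game Ua Wa P g al"
    and pol: "\<And>\<omega>. \<omega> \<in> space G \<Longrightarrow> is_policy Ua (mu \<omega>) \<and> is_policy Wa (nu \<omega>)"
    and meas: "\<And>s u. (\<lambda>\<omega>. mu \<omega> s u) \<in> borel_measurable G" "\<And>s v. (\<lambda>\<omega>. nu \<omega> s v) \<in> borel_measurable G"
  shows "(\<lambda>\<omega>. Jpol Ua Wa P g al (mu \<omega>) (nu \<omega>) s) \<in> borel_measurable G"
proof (rule borel_measurable_LIMSEQ_real)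
  fix \<omega> assume "\<omega> \<in> space G"
  then have *: "is_policy Ua (mu \<omega>)" "is_policy Wa (nu \<omega>)" using pol by auto
  show "(\<lambda>n. (Tpol Ua Wa P g al (mu \<omega>) (nu \<omega>) ^^ n) (\<lambda>_. 0) s)
      \<longlonglongrightarrow> Jpol Ua Wa P g al (mu \<omega>) (nu \<omega>) s"
    by (rule sup_contraction_funpow_tendsto[OF Tpol_contraction[OF game *] Tpol_Jpol[OF game *]])
qed (rule Tpol_funpow_measurable[OF meas])

text \<open>The set \<open>D\<close> takes finitely many values, so the random operator is a finite
  sum of indicators times fixed linear maps.\<close>

lemma Mop_measurable:
  fixes Phi :: "'s::finite \<Rightarrow> 'd::finite \<Rightarrow> real"
  assumes "\<And>S. (\<lambda>\<omega>. indicator {\<omega>'. D \<omega>' = S} \<omega> :: real) \<in> borel_measurable G"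
    and X: "\<And>t. (\<lambda>\<omega>. X \<omega> t) \<in> borel_measurable G"
  shows "(\<lambda>\<omega>. Mop Phi (D \<omega>) (X \<omega>) s) \<in> borel_measurable G"
proof -
  have "Mop Phi (D \<omega>) (X \<omega>) s = (\<Sum>S\<in>UNIV. indicator {\<omega>'. D \<omega>' = S} \<omega> * Mop Phi S (X \<omega>) s)" for \<omega>
    by (subst sum.remove[of UNIV "D \<omega>"]) (auto intro!: sum.neutral)
  moreover have "(\<lambda>\<omega>. \<Sum>S\<in>UNIV. indicator {\<omega>'. D \<omega>' = S} \<omega> * Mop Phi S (X \<omega>) s) \<in> borel_measurable G"
    unfolding Mop_def using assms
    by (intro borel_measurable_sum borel_measurable_times borel_measurable_const)
  ultimately show ?thesis by simp
qed

section \<open>Moment bounds and suprema for the iteration\<close>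

lemma supnorm_sq_le: "(supnorm X)\<^sup>2 \<le> (\<Sum>s\<in>UNIV. (X s)\<^sup>2)"
proof -
  have "supnorm X \<in> range (\<lambda>s. \<bar>X s\<bar>)" unfolding supnorm_def by (rule Max_in) auto
  then obtain s where "supnorm X = \<bar>X s\<bar>" by blast
  then show ?thesis using member_le_sum[of s UNIV "\<lambda>s. (X s)\<^sup>2"] by simp
qed

text \<open>Separates the deterministic size of the policy value from the noise, by
  \<open>(a + b)^2 \<le> 2 * a^2 + 2 * b^2\<close>, so that a second-moment bound on
  \<open>w\<close> yields one on the total noise.\<close>

lemma Mop_residual_sq_le:
  assumes K: "matnorm_inf (Mmat Phi S) \<le> K" and J: "supnorm J \<le> c"
  shows "(Mop Phi S (\<lambda>t. J t + w t) s - J s)\<^sup>2 \<le> 2 * (K * c + c)\<^sup>2 + 2 * K\<^sup>2 * (\<Sum>t\<in>UNIV. (w t)\<^sup>2)"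
proof -
  have K0: "0 \<le> K" using matnorm_inf_nonneg K by (rule order_trans)
  have Jw: "supnorm (\<lambda>t. J t + w t) \<le> c + supnorm w"
  proof (rule supnorm_le)
    fix t show "\<bar>J t + w t\<bar> \<le> c + supnorm w"
      using abs_le_supnorm[of J t] abs_le_supnorm[of w t] J by linarith
  qed
  have "\<bar>Mop Phi S (\<lambda>t. J t + w t) s\<bar> \<le> matnorm_inf (Mmat Phi S) * supnorm (\<lambda>t. J t + w t)"
    by (rule abs_Mop_le)
  also have "\<dots> \<le> K * (c + supnorm w)" by (intro mult_mono K Jw K0 supnorm_nonneg)
  finally have "\<bar>Mop Phi S (\<lambda>t. J t + w t) s - J s\<bar> \<le> (K * c + c) + K * supnorm w"
    using abs_le_supnorm[of J s] J by (simp add: distrib_left)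
  then have "(Mop Phi S (\<lambda>t. J t + w t) s - J s)\<^sup>2 \<le> ((K * c + c) + K * supnorm w)\<^sup>2"
    by (metis abs_ge_zero power2_abs power_mono)
  also have "\<dots> \<le> 2 * (K * c + c)\<^sup>2 + 2 * (K * supnorm w)\<^sup>2"
    using sum_squares_bound[of "K * c + c" "K * supnorm w"] by (simp add: power2_sum)
  also have "\<dots> \<le> 2 * (K * c + c)\<^sup>2 + 2 * K\<^sup>2 * (\<Sum>t\<in>UNIV. (w t)\<^sup>2)"
    using supnorm_sq_le[of w] by (simp add: power_mult_distrib mult_left_mono)
  finally show ?thesis .
qed

text \<open>Monotonicity of conditional expectation is applied to both \<open>f\<close> and
  \<open>- f\<close>.\<close>

lemma (in prob_space) abs_cond_exp_le_cond_exp: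
  assumes sub: "subalgebra M G" and f: "integrable M f" and h: "integrable M h"
    and le: "\<And>\<omega>. \<bar>f \<omega>\<bar> \<le> h \<omega>"
  shows "AE \<omega> in M. \<bar>real_cond_exp M G f \<omega>\<bar> \<le> real_cond_exp M G h \<omega>"
proof -
  interpret G: finite_measure_subalgebra M G by unfold_locales (rule sub)
  have le': "f \<omega> \<le> h \<omega>" "- 1 * f \<omega> \<le> h \<omega>" for \<omega> using le[of \<omega>] by auto
  have "AE \<omega> in M. real_cond_exp M G f \<omega> \<le> real_cond_exp M G h \<omega>"
    by (rule G.real_cond_exp_mono) (use f h le' in auto)
  moreover have "AE \<omega> in M. real_cond_exp M G (\<lambda>\<omega>. - 1 * f \<omega>) \<omega> \<le> real_cond_exp M G h \<omega>"
    by (rule G.real_cond_exp_mono) (use f h le' in auto)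
  moreover have "AE \<omega> in M. real_cond_exp M G (\<lambda>\<omega>. - 1 * f \<omega>) \<omega> = - 1 * real_cond_exp M G f \<omega>"
    by (rule G.real_cond_exp_cmult[OF f])
  ultimately show ?thesis by eventually_elim auto
qed

text \<open>Real suprema are upper bounds only of bounded families; here \<open>f\<close> has a
  finite domain, so its maximum bounds everything. This makes \<open>dFV\<close> a genuine bound on
  every path.\<close>

lemma le_SUP_SUP_finite_range:
  fixes f :: "'b::finite \<Rightarrow> real"
  assumes "x \<in> A"
  shows "f (D k x) \<le> (SUP k. SUP x\<in>A. f (D k x))"
proof -
  define K where "K = Max (range f)"
  have K: "f y \<le> K" for y unfolding K_def by (rule Max_ge) auto
  have "f (D k x) \<le> (SUP x\<in>A. f (D k x))"
    using assms K by (intro cSUP_upper bdd_aboveI2[of _ _ K])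
  also have "\<dots> \<le> (SUP k. SUP x\<in>A. f (D k x))"
    using assms K by (intro cSUP_upper[of k UNIV "\<lambda>k. SUP x\<in>A. f (D k x)"] bdd_aboveI2[of _ _ K] cSUP_least) auto
  finally show ?thesis .
qed

theorem theorem3:
  fixes Ua :: "'s::finite \<Rightarrow> 'u set" and Wa :: "'s \<Rightarrow> 'v set"
    and P :: "'s \<Rightarrow> 'u \<Rightarrow> 'v \<Rightarrow> 's \<Rightarrow> real" and g :: "'s \<Rightarrow> 'u \<Rightarrow> 'v \<Rightarrow> real"
    and al :: real and H m :: nat
    and Phi :: "'s \<Rightarrow> 'd::finite \<Rightarrow> real"
    and p :: "'s \<Rightarrow> real" and Ltraj :: "nat \<Rightarrow> nat"
    and M :: "'w measure" and F :: "nat \<Rightarrow> 'w measure"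
    and theta :: "nat \<Rightarrow> 'w \<Rightarrow> 'd \<Rightarrow> real"
    and V :: "nat \<Rightarrow> 'w \<Rightarrow> 's \<Rightarrow> real"
    and mu :: "nat \<Rightarrow> 'w \<Rightarrow> 's \<Rightarrow> 'u \<Rightarrow> real" and nu :: "nat \<Rightarrow> 'w \<Rightarrow> 's \<Rightarrow> 'v \<Rightarrow> real"
    and D :: "nat \<Rightarrow> 'w \<Rightarrow> 's set"
    and w :: "nat \<Rightarrow> 'w \<Rightarrow> 's \<Rightarrow> real"
    and gamma :: "nat \<Rightarrow> real"
    and Csec :: real and dFV dapp :: real
  assumes game: "markov_game Ua Wa P g al"
    and H: "H \<ge> 1" and m: "m \<ge> 1"
    and p_distr: "is_distr UNIV p" and p_pos: "\<forall>s. p s > 0"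
    and prob: "prob_space M"
    and filt_sub: "\<forall>k. subalgebra M (F k)"
    and filt_mono: "\<forall>k. sets (F k) \<subseteq> sets (F (Suc k))"
    and V_def: "\<forall>k. \<forall>\<omega>\<in>space M. \<forall>s. V k \<omega> s = (\<Sum>j\<in>UNIV. Phi s j * theta k \<omega> j)"
    and theta_meas: "\<forall>k j. (\<lambda>\<omega>. theta k \<omega> j) \<in> borel_measurable (F k)"
    and pol_meas: "\<forall>k s. (\<forall>u. (\<lambda>\<omega>. mu (Suc k) \<omega> s u) \<in> borel_measurable (F k)) \<and>
                         (\<forall>v. (\<lambda>\<omega>. nu (Suc k) \<omega> s v) \<in> borel_measurable (F k))"
    and pol_valid: "\<forall>k. \<forall>\<omega>\<in>space M. is_policy Ua (mu (Suc k) \<omega>) \<and> is_policy Wa (nu (Suc k) \<omega>)"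
    and pol_greedy: "\<forall>k. \<forall>\<omega>\<in>space M.
          Tpol Ua Wa P g al (mu (Suc k) \<omega>) (nu (Suc k) \<omega>) ((Tbell Ua Wa P g al ^^ (H - 1)) (V k \<omega>))
          = (Tbell Ua Wa P g al ^^ H) (V k \<omega>)"
    and D_meas: "\<forall>k S. (\<lambda>\<omega>. indicator {\<omega>'. D k \<omega>' = S} \<omega> :: real) \<in> borel_measurable (F (Suc k))"
    and D_law: "\<forall>k S. AE \<omega> in M.
          real_cond_exp M (F k) (\<lambda>\<omega>'. indicator {\<omega>'. D k \<omega>' = S} \<omega>') \<omega>
          = traj_visit_prob Ua Wa P p (Ltraj k) (mu (Suc k) \<omega>) (nu (Suc k) \<omega>) S"
    and w_meas: "\<forall>k s. (\<lambda>\<omega>. w k \<omega> s) \<in> borel_measurable (F (Suc k))"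
    and w_int: "\<forall>k s. integrable M (\<lambda>\<omega>. (w k \<omega> s)\<^sup>2)"
    and w_unbiased: "\<forall>k s. AE \<omega> in M. real_cond_exp M (F k) (\<lambda>\<omega>'. w k \<omega>' s) \<omega> = 0"
    and w_second: "\<forall>k. AE \<omega> in M. real_cond_exp M (F k) (\<lambda>\<omega>'. \<Sum>s\<in>UNIV. (w k \<omega>' s)\<^sup>2) \<omega> \<le> Csec"
    and iter: "\<forall>k. \<forall>\<omega>\<in>space M. \<forall>s. V (Suc k) \<omega> s =
          (1 - gamma k) * V k \<omega> s
          + gamma k * Mop Phi (D k \<omega>)
              (\<lambda>t. (Tpol Ua Wa P g al (mu (Suc k) \<omega>) (nu (Suc k) \<omega>) ^^ m)
                     ((Tbell Ua Wa P g al ^^ (H - 1)) (V k \<omega>)) t + w k \<omega> t) s"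
    and gamma_nonneg: "\<forall>k. 0 \<le> gamma k"
    and gamma_sum: "\<not> summable gamma"
    and gamma_sq: "summable (\<lambda>k. (gamma k)\<^sup>2)"
    and dFV_def: "dFV = (SUP k. SUP \<omega>\<in>space M. matnorm_inf (Mmat Phi (D k \<omega>)))"
    and dapp_def: "(SUP k. esssup M (\<lambda>\<omega>. ereal (real_cond_exp M (F k)
          (\<lambda>\<omega>'. supnorm (\<lambda>s.
             Mop Phi (D k \<omega>') (\<lambda>t. Jpol Ua Wa P g al (mu (Suc k) \<omega>') (nu (Suc k) \<omega>') t + w k \<omega>' t) s
             - (Jpol Ua Wa P g al (mu (Suc k) \<omega>') (nu (Suc k) \<omega>') s + w k \<omega>' s))) \<omega>)))
          = ereal dapp"
    and contr: "dFV * al ^ (m + H - 1) * (1 + al) / (1 - al) + 2 * al ^ (H - 1) / (1 - al) < 1"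
  shows "AE \<omega> in M.
           limsup (\<lambda>k. ereal (supnorm (\<lambda>s. V k \<omega> s - Jstar Ua Wa P g al s)))
           \<le> ereal (dapp / (1 - (al ^ (H - 1)
                 + (1 + al) * ((1 + al ^ m * dFV) * al ^ (H - 1)) / (1 - al))))"
proof -
  interpret prob_space M by (rule prob)
  define J where "J k \<omega> = Jpol Ua Wa P g al (mu (Suc k) \<omega>) (nu (Suc k) \<omega>)" for k \<omega>
  define Js where "Js = Jstar Ua Wa P g al"
  define beta where "beta = al ^ (H - 1) + (1 + al) * ((1 + al ^ m * dFV) * al ^ (H - 1)) / (1 - al)"
  define Z where "Z k \<omega> s = Mop Phi (D k \<omega>) (\<lambda>t. J k \<omega> t + w k \<omega> t) s - J k \<omega> s" for k \<omega> s
  define x where "x k \<omega> s = V k \<omega> s - Js s" for k \<omega> s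
  define a where "a k \<omega> s = Mop Phi (D k \<omega>)
      (\<lambda>t. (Tpol Ua Wa P g al (mu (Suc k) \<omega>) (nu (Suc k) \<omega>) ^^ m)
             ((Tbell Ua Wa P g al ^^ (H - 1)) (V k \<omega>)) t - J k \<omega> t) s + (J k \<omega> s - Js s)" for k \<omega> s
  define N where "N k \<omega> = supnorm (\<lambda>s. Mop Phi (D k \<omega>) (\<lambda>t. J k \<omega> t + w k \<omega> t) s - (J k \<omega> s + w k \<omega> s))" for k \<omega>
  define c where "c = 1 / (1 - al)"
  have al: "0 < al" "al < 1" using game by (auto simp: markov_game_def)
  have filt: "filtered M F" using filt_sub filt_mono by (simp add: filtered_def)
  have spaceF: "space (F k) = space M" for k using filt_sub by (simp add: subalgebra_def)
  have dFV: "matnorm_inf (Mmat Phi (D k \<omega>)) \<le> dFV" if "\<omega> \<in> space M" for k \<omega>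
    unfolding dFV_def using le_SUP_SUP_finite_range[OF that, of "\<lambda>S. matnorm_inf (Mmat Phi S)"] .
  \<comment> \<open>A sample point exists because the space carries a probability; the supremum
    \<open>dFV\<close> inherits its sign from the norm there.\<close>
  obtain \<omega>0 where "\<omega>0 \<in> space M" using not_empty by blast
  then have dFV0: "0 \<le> dFV" using order_trans[OF matnorm_inf_nonneg dFV] by blast
  have beta0: "0 \<le> beta" using al dFV0 by (simp add: beta_def)
  \<comment> \<open>The assumed inequality is \<open>beta < 1\<close> in another form:
    \<open>1 + (1 + al) / (1 - al) = 2 / (1 - al)\<close>, and \<open>H \<ge> 1\<close> splits the
    exponent \<open>m + H - 1\<close> into \<open>m\<close> and \<open>H - 1\<close>.\<close>
  have "beta = dFV * al ^ (m + H - 1) * (1 + al) / (1 - al) + 2 * al ^ (H - 1) / (1 - al)"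
  proof -
    have "al ^ (m + H - 1) = al ^ m * al ^ (H - 1)" using H by (simp flip: power_add)
    then show ?thesis using al by (simp add: beta_def divide_simps) (simp add: algebra_simps)
  qed
  then have beta1: "beta < 1" using contr by simp
  \<comment> \<open>The policies of step \<open>Suc k\<close> are chosen from the history
    \<open>F k\<close>, so their value is already known at time \<open>k\<close>.\<close>
  have JF: "(\<lambda>\<omega>. J k \<omega> s) \<in> borel_measurable (F k)" for k s
    unfolding J_def by (rule Jpol_measurable[OF game]) (use pol_valid pol_meas spaceF in auto)
  have JF': "(\<lambda>\<omega>. J k \<omega> s) \<in> borel_measurable (F (Suc k))" for k s
    by (rule filtered_measurable_mono[OF filt _ JF]) simp
  have wF: "(\<lambda>\<omega>. w k \<omega> s) \<in> borel_measurable (F (Suc k))" for k s using w_meas by blast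
  have ZF: "(\<lambda>\<omega>. Z k \<omega> s) \<in> borel_measurable (F (Suc k))" for k s
    unfolding Z_def using D_meas JF' wF
    by (intro borel_measurable_diff Mop_measurable borel_measurable_add) auto
  have [measurable]: "(\<lambda>\<omega>. Z k \<omega> s) \<in> borel_measurable M" "(\<lambda>\<omega>. w k \<omega> s) \<in> borel_measurable M" for k s
    using filtered_measurable[OF filt] ZF wF by blast+
  have Zle: "(Z k \<omega> s)\<^sup>2 \<le> 2 * (dFV * c + c)\<^sup>2 + 2 * dFV\<^sup>2 * (\<Sum>t\<in>UNIV. (w k \<omega> t)\<^sup>2)"
    if "\<omega> \<in> space M" for k \<omega> s
    unfolding Z_def
  proof (rule Mop_residual_sq_le[OF dFV[OF that]])
    show "supnorm (J k \<omega>) \<le> c"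
      unfolding J_def c_def by (rule supnorm_Jpol_le[OF game]) (use pol_valid that in auto)
  qed
  have W: "integrable M (\<lambda>\<omega>. \<Sum>t\<in>UNIV. (w k \<omega> t)\<^sup>2)" for k using w_int by simp
  \<comment> \<open>Integrating the conditional bound gives an unconditional one, by the tower
    property.\<close>
  have WC: "(\<integral>\<omega>. (\<Sum>t\<in>UNIV. (w k \<omega> t)\<^sup>2) \<partial>M) \<le> Csec" for k
  proof -
    interpret G: finite_measure_subalgebra M "F k" by unfold_locales (use filt_sub in auto)
    have "(\<integral>\<omega>. (\<Sum>t\<in>UNIV. (w k \<omega> t)\<^sup>2) \<partial>M)
        = (\<integral>\<omega>. real_cond_exp M (F k) (\<lambda>\<omega>. \<Sum>t\<in>UNIV. (w k \<omega> t)\<^sup>2) \<omega> \<partial>M)"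
      by (rule G.real_cond_exp_int(2)[OF W, symmetric])
    also have "\<dots> \<le> (\<integral>\<omega>. Csec \<partial>M)"
      using G.real_cond_exp_int(1)[OF W] w_second by (intro integral_mono_AE) auto
    finally show ?thesis by (simp add: prob_space)
  qed
  have bound_int: "integrable M (\<lambda>\<omega>. 2 * (dFV * c + c)\<^sup>2 + 2 * dFV\<^sup>2 * (\<Sum>t\<in>UNIV. (w k \<omega> t)\<^sup>2))" for k
    by (intro Bochner_Integration.integrable_add integrable_mult_right W) simp
  have Z2: "integrable M (\<lambda>\<omega>. (Z k \<omega> s)\<^sup>2)" for k s
    by (rule Bochner_Integration.integrable_bound[OF bound_int[of k]])
      (use Zle in \<open>auto intro!: AE_I2 order_trans[OF _ abs_ge_self]\<close>)
  have ZC: "(\<integral>\<omega>. (Z k \<omega> s)\<^sup>2 \<partial>M) \<le> 2 * (dFV * c + c)\<^sup>2 + 2 * dFV\<^sup>2 * Csec" for k s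
  proof -
    have "(\<integral>\<omega>. (Z k \<omega> s)\<^sup>2 \<partial>M)
        \<le> (\<integral>\<omega>. 2 * (dFV * c + c)\<^sup>2 + 2 * dFV\<^sup>2 * (\<Sum>t\<in>UNIV. (w k \<omega> t)\<^sup>2) \<partial>M)"
      by (rule integral_mono[OF Z2 bound_int Zle])
    also have "\<dots> = 2 * (dFV * c + c)\<^sup>2 + 2 * dFV\<^sup>2 * (\<integral>\<omega>. (\<Sum>t\<in>UNIV. (w k \<omega> t)\<^sup>2) \<partial>M)"
      by (subst Bochner_Integration.integral_add)
        (use W[of k] in \<open>auto simp: prob_space simp del: Bochner_Integration.integral_sum\<close>)
    also have "\<dots> \<le> 2 * (dFV * c + c)\<^sup>2 + 2 * dFV\<^sup>2 * Csec"
      using WC[of k] by (intro add_left_mono mult_left_mono) auto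
    finally show ?thesis .
  qed
  have bias: "AE \<omega> in M. \<bar>real_cond_exp M (F k) (\<lambda>\<omega>. Z k \<omega> s) \<omega>\<bar> \<le> dapp" for k s
  proof -
    interpret G: finite_measure_subalgebra M "F k" by unfold_locales (use filt_sub in auto)
    have w1: "integrable M (\<lambda>\<omega>. w k \<omega> s)" for s
      by (rule square_integrable_imp_integrable) (use w_int in auto)
    have Z1: "integrable M (\<lambda>\<omega>. Z k \<omega> s)" for s
      by (rule square_integrable_imp_integrable) (use Z2 in auto)
    have B1: "integrable M (\<lambda>\<omega>. Z k \<omega> s - w k \<omega> s)" for s using Z1 w1 by simp
    \<comment> \<open>The vector measured by \<open>dapp\<close> is \<open>Z - w\<close>. As
      \<open>w\<close> has conditional mean zero, \<open>Z\<close> and \<open>Z - w\<close> have the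
      same conditional mean.\<close>
    have N_eq: "N k \<omega> = supnorm (\<lambda>s. Z k \<omega> s - w k \<omega> s)" for \<omega>
      by (simp add: N_def Z_def algebra_simps)
    have N1: "integrable M (N k)"
    proof (rule Bochner_Integration.integrable_bound)
      show "integrable M (\<lambda>\<omega>. \<Sum>s\<in>UNIV. \<bar>Z k \<omega> s - w k \<omega> s\<bar>)" using B1 by simp
      show "N k \<in> borel_measurable M" unfolding N_eq[abs_def] supnorm_def by measurable
      have "supnorm X \<le> (\<Sum>s\<in>UNIV. \<bar>X s\<bar>)" for X :: "'s \<Rightarrow> real"
        by (intro supnorm_le member_le_sum) auto
      then show "AE \<omega> in M. norm (N k \<omega>) \<le> norm (\<Sum>s\<in>UNIV. \<bar>Z k \<omega> s - w k \<omega> s\<bar>)"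
        by (simp add: N_eq supnorm_nonneg sum_nonneg)
    qed
    \<comment> \<open>The essential supremum at index \<open>k\<close> lies below the supremum over
      all indices, which is the finite number \<open>dapp\<close>; it bounds the conditional
      expectation almost everywhere.\<close>
    have "ereal (real_cond_exp M (F k) (N k) \<omega>) \<le> ereal dapp"
      if "ereal (real_cond_exp M (F k) (N k) \<omega>) \<le> esssup M (\<lambda>\<omega>. ereal (real_cond_exp M (F k) (N k) \<omega>))" for \<omega>
      using that unfolding dapp_def[symmetric] N_def[abs_def] J_def
      by (rule order_trans) (rule SUP_upper[of k UNIV], simp)
    then have "AE \<omega> in M. ereal (real_cond_exp M (F k) (N k) \<omega>) \<le> ereal dapp"
      using esssup_AE[of "\<lambda>\<omega>. ereal (real_cond_exp M (F k) (N k) \<omega>)" M] by (auto elim: eventually_mono)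
    moreover have "AE \<omega> in M. \<bar>real_cond_exp M (F k) (\<lambda>\<omega>. Z k \<omega> s - w k \<omega> s) \<omega>\<bar> \<le> real_cond_exp M (F k) (N k) \<omega>"
      by (rule abs_cond_exp_le_cond_exp[OF G.subalg B1 N1]) (simp add: N_eq abs_le_supnorm[of "\<lambda>s. Z k _ s - w k _ s"])
    moreover have "AE \<omega> in M. real_cond_exp M (F k) (\<lambda>\<omega>. Z k \<omega> s - w k \<omega> s) \<omega>
        = real_cond_exp M (F k) (\<lambda>\<omega>. Z k \<omega> s) \<omega> - real_cond_exp M (F k) (\<lambda>\<omega>. w k \<omega> s) \<omega>"
      by (rule G.real_cond_exp_diff[OF Z1 w1])
    moreover have "AE \<omega> in M. real_cond_exp M (F k) (\<lambda>\<omega>. w k \<omega> s) \<omega> = 0" using w_unbiased by blast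
    ultimately show ?thesis by eventually_elim auto
  qed
  have rec: "x (Suc k) \<omega> s = (1 - gamma k) * x k \<omega> s + gamma k * (a k \<omega> s + Z k \<omega> s)"
    if "\<omega> \<in> space M" for k \<omega> s
  proof -
    let ?X = "(Tpol Ua Wa P g al (mu (Suc k) \<omega>) (nu (Suc k) \<omega>) ^^ m) ((Tbell Ua Wa P g al ^^ (H - 1)) (V k \<omega>))"
    \<comment> \<open>By linearity the operator value at \<open>?X + w\<close> is its value at
      \<open>?X - J\<close> plus its value at \<open>J + w\<close>. The term \<open>J\<close> added
      in \<open>a\<close> and subtracted in \<open>Z\<close> cancels, and only \<open>Js\<close>
      remains.\<close>
    have "Mop Phi (D k \<omega>) (\<lambda>t. ?X t + w k \<omega> t) s - Mop Phi (D k \<omega>) (\<lambda>t. J k \<omega> t + w k \<omega> t) s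
        = Mop Phi (D k \<omega>) (\<lambda>t. ?X t - J k \<omega> t) s"
      by (simp add: Mop_diff)
    then have "Mop Phi (D k \<omega>) (\<lambda>t. ?X t + w k \<omega> t) s = a k \<omega> s + Z k \<omega> s + Js s"
      by (simp add: a_def Z_def)
    then show ?thesis using iter that by (simp add: x_def algebra_simps)
  qed
  have drift: "\<bar>a k \<omega> s\<bar> \<le> beta * supnorm (x k \<omega>)" if "\<omega> \<in> space M" for k \<omega> s
    unfolding a_def J_def Js_def beta_def x_def[abs_def]
    by (rule drift_le[OF game _ _ H _ dFV[OF that]]) (use pol_valid pol_greedy that in auto)
  have "AE \<omega> in M. limsup (\<lambda>k. ereal (supnorm (x k \<omega>))) \<le> ereal (dapp / (1 - beta))"
    by (rule stochastic_contraction_limsup[OF filt beta0 beta1 _ gamma_sum gamma_sq ZF Z2 ZC bias rec drift])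
      (use gamma_nonneg in auto)
  then show ?thesis by (simp only: x_def[abs_def] Js_def beta_def)
qed

end
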